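(* There exists an absolute constant $C>0$ such that the following holds. Let $r\ge 0$, $n,d\ge 1$ be integers, $N=n^d$, $\sigma>0$, $\theta^*\in\mathbb{R}^{L_{d,n}}$ and $y=\theta^*+\sigma Z$, where $Z$ has independent standard Gaussian entries. For any $0<\delta<1$ and any $\lambda\ge C K_{r,d}\,\frac{\sigma^2\log N}{\delta}$, for each $a\in\{\mathrm{rdp},\mathrm{hier},\mathrm{all}\}$, $$\mathbb{E}\|\hat\theta^{(r)}_{a,\lambda}-\theta^*\|^2\le \inf_{\theta\in\mathbb{R}^{L_{d,n}}}\Big[\frac{1+\delta}{1-\delta}\|\theta-\theta^*\|^2+\frac{\lambda}{1-\delta}\,k^{(r)}_a(\theta)\Big]+C\,\frac{\sigma^2}{\delta(1-\delta)}.$$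
   Context: Let $L_{d,n}=\{1,\dots,n\}^d$, $N=n^d$; arrays in $\mathbb{R}^{L_{d,n}}$ are identified with vectors in $\mathbb{R}^N$ with Euclidean norm $\|\cdot\|$. A rectangle is a nonempty product of integer intervals $\prod_{i=1}^d[a_i,b_i]\subset L_{d,n}$. A rectangular partition $\Pi$ is a set of pairwise disjoint rectangles with union $L_{d,n}$; $|\Pi|$ is its cardinality; $\mathcal{P}_{\mathrm{all},d,n}$ is the set of all of them. $S^{(r)}(\Pi)$ is the linear subspace of arrays $\theta$ such that on each rectangle of $\Pi$, $\theta$ agrees with $(i_1,\dots,i_d)\mapsto f(i_1/n,\dots,i_d/n)$ for some polynomial $f$ in $d$ variables of total degree at most $r$. $O_S$ denotes orthogonal projection onto a subspace $S$. $K_{r,d}=\binom{r+d}{d}$ is the dimension of the space of polynomials in $d$ variables of total degree at most $r$. A hierarchical split of a rectangle chooses a coordinate $j$ and replaces $[a_j,b_j]$ by $[a_j,\ell]$ and $[\ell+1,b_j]$ for some $a_j\le \ell<b_j$, giving two rectangles. A dyadic split is the special case where $a_j<b_j$ and $\ell=a_j-1+\lceil (b_j-a_j+1)/2\rceil$. $\mathcal{P}_{\mathrm{hier},d,n}$ (resp. $\mathcal{P}_{\mathrm{rdp},d,n}$) is the set of all partitions obtainable from $\{L_{d,n}\}$ by finitely many successive hierarchical (resp. dyadic) splits of constituent rectangles. For $a\in\{\mathrm{rdp},\mathrm{hier},\mathrm{all}\}$, $\hat\theta^{(r)}_{a,\lambda}=O_{S^{(r)}(\hat\Pi)}y$ where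 $\hat\Pi$ is a (measurably chosen) minimizer of $\|y-O_{S^{(r)}(\Pi)}y\|^2+\lambda|\Pi|$ over $\Pi\in\mathcal{P}_{a,d,n}$, and $k^{(r)}_a(\theta)=\min\{|\Pi|:\Pi\in\mathcal{P}_{a,d,n},\ \theta\in S^{(r)}(\Pi)\}$. *)

theory Defs
  imports "HOL-Probability.Probability" "HOL-Library.Disjoint_Sets"
begin

text \<open>
  Since \<open>d\<close> and \<open>n\<close> are quantified after the absolute constant, they cannot be encoded as types.
  Points of the lattice are extensional functions on \<open>{1..d}\<close>, and arrays are extensional functions
  on the lattice, so that equality of arrays is equality of functions.
\<close>

type_synonym point = "nat \<Rightarrow> nat"
type_synonym arr = "point \<Rightarrow> real"

definition grid :: "nat \<Rightarrow> nat \<Rightarrow> point set" where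
  "grid d n = {1..d} \<rightarrow>\<^sub>E {1..n}"

definition arrays :: "nat \<Rightarrow> nat \<Rightarrow> arr set" where
  "arrays d n = grid d n \<rightarrow>\<^sub>E UNIV"

definition box :: "nat \<Rightarrow> (nat \<Rightarrow> nat) \<Rightarrow> (nat \<Rightarrow> nat) \<Rightarrow> point set" where
  "box d a b = (\<Pi>\<^sub>E j\<in>{1..d}. {a j..b j})"

definition rectangle :: "nat \<Rightarrow> nat \<Rightarrow> point set \<Rightarrow> bool" where
  "rectangle d n R \<longleftrightarrow> R \<noteq> {} \<and> R \<subseteq> grid d n \<and> (\<exists>a b. R = box d a b)"

definition all_partitions :: "nat \<Rightarrow> nat \<Rightarrow> point set set set" where
  "all_partitions d n = {P. partition_on (grid d n) P \<and> (\<forall>R\<in>P. rectangle d n R)}"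

inductive_set hier_partitions :: "nat \<Rightarrow> nat \<Rightarrow> point set set set" for d n :: nat where
  whole: "{grid d n} \<in> hier_partitions d n"
| split: "\<lbrakk>P \<in> hier_partitions d n; box d a b \<in> P; j \<in> {1..d}; a j \<le> l; l < b j\<rbrakk>
    \<Longrightarrow> (P - {box d a b}) \<union> {box d a (b(j := l)), box d (a(j := l + 1)) b}
        \<in> hier_partitions d n"

inductive_set rdp_partitions :: "nat \<Rightarrow> nat \<Rightarrow> point set set set" for d n :: nat where
  whole: "{grid d n} \<in> rdp_partitions d n"
| split: "\<lbrakk>P \<in> rdp_partitions d n; box d a b \<in> P; j \<in> {1..d}; a j < b j;
      int l = int (a j) - 1 + \<lceil>(real (b j) - real (a j) + 1) / 2\<rceil>\<rbrakk>
    \<Longrightarrow> (P - {box d a b}) \<union> {box d a (b(j := l)), box d (a(j := l + 1)) b}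
        \<in> rdp_partitions d n"

datatype partition_class = Rdp | Hier | All

fun partitions :: "partition_class \<Rightarrow> nat \<Rightarrow> nat \<Rightarrow> point set set set" where
  "partitions Rdp d n = rdp_partitions d n"
| "partitions Hier d n = hier_partitions d n"
| "partitions All d n = all_partitions d n"

definition multi_indices :: "nat \<Rightarrow> nat \<Rightarrow> (nat \<Rightarrow> nat) set" where
  "multi_indices d r = {\<alpha> \<in> {1..d} \<rightarrow>\<^sub>E {0..r}. (\<Sum>j=1..d. \<alpha> j) \<le> r}"

definition poly_funs :: "nat \<Rightarrow> nat \<Rightarrow> ((nat \<Rightarrow> real) \<Rightarrow> real) set" where
  "poly_funs d r = {f. \<exists>c. \<forall>x. f x = (\<Sum>\<alpha>\<in>multi_indices d r. c \<alpha> * (\<Prod>j=1..d. x j ^ \<alpha> j))}"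

definition piecewise_poly :: "nat \<Rightarrow> nat \<Rightarrow> nat \<Rightarrow> point set set \<Rightarrow> arr set" where
  "piecewise_poly r d n P = {\<theta> \<in> arrays d n. \<forall>R\<in>P. \<exists>f\<in>poly_funs d r. \<forall>i\<in>R.
     \<theta> i = f (\<lambda>j. real (i j) / real n)}"

definition orth_proj :: "nat \<Rightarrow> nat \<Rightarrow> arr set \<Rightarrow> arr \<Rightarrow> arr" where
  "orth_proj d n S y = (THE p. p \<in> S \<and> (\<forall>s\<in>S. (\<Sum>i\<in>grid d n. (y i - p i) * s i) = 0))"

definition penalized_loss :: "nat \<Rightarrow> nat \<Rightarrow> nat \<Rightarrow> real \<Rightarrow> arr \<Rightarrow> point set set \<Rightarrow> real" where
  "penalized_loss r d n lam y P =
     (L2_set (\<lambda>i. y i - orth_proj d n (piecewise_poly r d n P) y i) (grid d n))\<^sup>2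
       + lam * real (card P)"

text \<open>A measurable choice, as a function of the data, of a minimizing partition.\<close>

definition optimal_selector ::
  "partition_class \<Rightarrow> nat \<Rightarrow> nat \<Rightarrow> nat \<Rightarrow> real \<Rightarrow> (arr \<Rightarrow> point set set) \<Rightarrow> bool" where
  "optimal_selector a r d n lam sel \<longleftrightarrow>
     sel \<in> (\<Pi>\<^sub>M i\<in>grid d n. borel) \<rightarrow>\<^sub>M count_space (partitions a d n) \<and>
     (\<forall>y\<in>arrays d n. \<forall>P\<in>partitions a d n.
        penalized_loss r d n lam y (sel y) \<le> penalized_loss r d n lam y P)"

definition estimator :: "nat \<Rightarrow> nat \<Rightarrow> nat \<Rightarrow> (arr \<Rightarrow> point set set) \<Rightarrow> arr \<Rightarrow> arr" where
  "estimator r d n sel y = orth_proj d n (piecewise_poly r d n (sel y)) y"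

definition complexity :: "partition_class \<Rightarrow> nat \<Rightarrow> nat \<Rightarrow> nat \<Rightarrow> arr \<Rightarrow> nat" where
  "complexity a r d n \<theta> = Min {card P |P. P \<in> partitions a d n \<and> \<theta> \<in> piecewise_poly r d n P}"

definition observation :: "nat \<Rightarrow> nat \<Rightarrow> real \<Rightarrow> arr \<Rightarrow> arr \<Rightarrow> arr" where
  "observation d n \<sigma> \<theta>s z = (\<lambda>i\<in>grid d n. \<theta>s i + \<sigma> * z i)"

definition gaussian_noise :: "nat \<Rightarrow> nat \<Rightarrow> arr measure" where
  "gaussian_noise d n = (\<Pi>\<^sub>M i\<in>grid d n. density lborel (\<lambda>x. ennreal (std_normal_density x)))"

text \<open>
  \<^const>\<open>gaussian_noise\<close> is the law of any array of independent standard Gaussians. Expectations are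
  taken under this law, because quantifying over probability spaces on a type variable
  would let the constant depend on that type.
\<close>

lemma distr_gaussian_noise:
  assumes "prob_space M" and "n \<ge> 1"
    and "prob_space.indep_vars M (\<lambda>_. borel) Z (grid d n)"
    and "\<And>i. i \<in> grid d n \<Longrightarrow> distributed M lborel (Z i) (\<lambda>x. ennreal (std_normal_density x))"
  shows "distr M (\<Pi>\<^sub>M i\<in>grid d n. borel) (\<lambda>\<omega>. \<lambda>i\<in>grid d n. Z i \<omega>) = gaussian_noise d n"
proof -
  interpret prob_space M by fact
  have "grid d n \<noteq> {}"
    using assms(2) by (auto simp: grid_def PiE_eq_empty_iff)
  moreover have rv: "random_variable borel (Z i)" if "i \<in> grid d n" for i
    using assms(4)[OF that] by (simp add: distributed_def)
  ultimately have "distr M (\<Pi>\<^sub>M i\<in>grid d n. borel) (\<lambda>\<omega>. \<lambda>i\<in>grid d n. Z i \<omega>)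
      = (\<Pi>\<^sub>M i\<in>grid d n. distr M borel (Z i))"
    using indep_vars_iff_distr_eq_PiM'[where I = "grid d n" and M' = "\<lambda>_. borel" and X = Z] assms(3) by simp
  also have "\<dots> = gaussian_noise d n"
    unfolding gaussian_noise_def
  proof (rule PiM_cong[OF refl])
    fix i assume "i \<in> grid d n"
    then have "distr M lborel (Z i) = density lborel (\<lambda>x. ennreal (std_normal_density x))"
      using assms(4) by (simp add: distributed_def)
    moreover have "distr M borel (Z i) = distr M lborel (Z i)"
      by (rule distr_cong) simp_all
    ultimately show "distr M borel (Z i) = density lborel (\<lambda>x. ennreal (std_normal_density x))"
      by simp
  qed
  finally show ?thesis .
qed

end

theory Submission
  imports Defs
begin

text \<open>
  Let \<open>p\<close> be the estimator, \<open>P\<close> its partition and \<open>\<theta> \<in> S(Q)\<close> a competitor. Comparing penalized losses bounds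
  \<open>(1 - \<delta>) \<parallel>p - \<theta>s\<parallel>\<^sup>2\<close> by \<open>(1 + \<delta>) \<parallel>\<theta> - \<theta>s\<parallel>\<^sup>2 + \<lambda> |Q|\<close> plus \<open>2 \<sigma>\<^sup>2 W P / \<delta> - \<lambda> |P|\<close>, where
  \<open>W P\<close> is the squared norm of the projection of the noise onto \<open>S(P) + span \<theta>\<close>, a space of
  dimension \<open>m \<le> |P| K + 1\<close>. Using \<open>x \<le> 4 exp (x / 4)\<close>, the last term is at most a multiple of the sum over
  all partitions of \<open>exp (W P / 4 - L |P| / 4)\<close> with \<open>L = \<lambda> \<delta> / (2 \<sigma>\<^sup>2)\<close>. Since \<open>E exp (W P / 4) = 2\<^bsup>m / 2\<^esup>\<close>, each
  expectation is at most \<open>\<surd>2 N\<^bsup>-2 |P|\<^esup>\<close>; as there are at most \<open>N\<^sup>2\<close> rectangles, the expected sum is at most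
  \<open>\<surd>2 (1 + N\<^bsup>-2\<^esup>)\<^bsup>N\<^sup>2\<^esup> \<le> \<surd>2 e\<close>.
\<close>

section \<open>Finite-dimensional Euclidean geometry\<close>

definition dot :: "'a set \<Rightarrow> ('a \<Rightarrow> real) \<Rightarrow> ('a \<Rightarrow> real) \<Rightarrow> real" where
  "dot A f g = (\<Sum>i\<in>A. f i * g i)"

text \<open>Only values on \<open>A\<close> count, here and in \<open>dot\<close>, so the
  \<open>undefined\<close> entries of extensional arrays never interfere. The generators
  \<open>v\<close> may be linearly dependent.\<close>

definition spanned :: "'a set \<Rightarrow> 'b set \<Rightarrow> ('b \<Rightarrow> 'a \<Rightarrow> real) \<Rightarrow> ('a \<Rightarrow> real) \<Rightarrow> bool" where
  "spanned A L v f \<longleftrightarrow> (\<exists>c. \<forall>i\<in>A. f i = (\<Sum>l\<in>L. c l * v l i))"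

definition orthonormal :: "'a set \<Rightarrow> nat \<Rightarrow> (nat \<Rightarrow> 'a \<Rightarrow> real) \<Rightarrow> bool" where
  "orthonormal A m e \<longleftrightarrow> (\<forall>j<m. \<forall>k<m. dot A (e j) (e k) = (if j = k then 1 else 0))"

lemma L2_set_power2: "(L2_set f A)\<^sup>2 = dot A f f"
  by (simp add: L2_set_def dot_def power2_eq_square sum_nonneg)

lemma dot_self_nonneg: "0 \<le> dot A f f"
  by (simp add: dot_def sum_nonneg)

lemma dot_commute: "dot A f g = dot A g f"
  by (simp add: dot_def mult.commute)

lemma dot_cong: "(\<And>i. i \<in> A \<Longrightarrow> f i = f' i) \<Longrightarrow> (\<And>i. i \<in> A \<Longrightarrow> g i = g' i) \<Longrightarrow> dot A f g = dot A f' g'"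
  by (simp add: dot_def)

lemma dot_diff_right: "dot A f (\<lambda>i. g i - h i) = dot A f g - dot A f h"
  by (simp add: dot_def algebra_simps sum_subtractf)

lemma dot_diff_left: "dot A (\<lambda>i. g i - h i) f = dot A g f - dot A h f"
  by (simp add: dot_def algebra_simps sum_subtractf)

lemma dot_scale_right: "dot A f (\<lambda>i. c * g i) = c * dot A f g"
  by (simp add: dot_def sum_distrib_left algebra_simps)

lemma dot_scale_left: "dot A (\<lambda>i. c * g i) f = c * dot A g f"
  by (simp add: dot_def sum_distrib_left algebra_simps)

lemma dot_sum_right: "dot A f (\<lambda>i. \<Sum>j\<in>J. c j * e j i) = (\<Sum>j\<in>J. c j * dot A f (e j))"
  unfolding dot_def sum_distrib_left
  by (subst sum.swap) (simp add: algebra_simps)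

lemma dot_self_eq_0: "finite A \<Longrightarrow> dot A f f = 0 \<Longrightarrow> i \<in> A \<Longrightarrow> f i = 0"
  by (simp add: dot_def sum_nonneg_eq_0_iff)

lemma dot_Cauchy_Schwarz: "(dot A f g)\<^sup>2 \<le> dot A f f * dot A g g"
  using Cauchy_Schwarz_ineq_sum[of f g A] by (simp add: dot_def power2_eq_square)

text \<open>Write f - g as (f - h) - (g - h): in each coordinate, twice the sum of the two squares
  exceeds the square of the difference by the square of the sum.\<close>

lemma dot_self_diff_le: "dot A (\<lambda>i. f i - g i) (\<lambda>i. f i - g i)
    \<le> 2 * dot A (\<lambda>i. f i - h i) (\<lambda>i. f i - h i) + 2 * dot A (\<lambda>i. g i - h i) (\<lambda>i. g i - h i)"
  unfolding dot_def sum_distrib_left sum.distrib[symmetric]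
proof (rule sum_mono)
  fix i
  have "0 \<le> ((f i - h i) + (g i - h i))\<^sup>2" by simp
  then show "(f i - g i) * (f i - g i)
      \<le> 2 * ((f i - h i) * (f i - h i)) + 2 * ((g i - h i) * (g i - h i))"
    by (simp add: power2_eq_square algebra_simps)
qed

lemma spanned_combine:
  assumes "spanned A L v f" "spanned A L v g" "\<And>i. i \<in> A \<Longrightarrow> h i = a * f i + b * g i"
  shows "spanned A L v h"
proof -
  from assms obtain c c' where "\<forall>i\<in>A. f i = (\<Sum>l\<in>L. c l * v l i)" "\<forall>i\<in>A. g i = (\<Sum>l\<in>L. c' l * v l i)"
    by (auto simp: spanned_def)
  with assms(3) show ?thesis
    unfolding spanned_def
    by (intro exI[of _ "\<lambda>l. a * c l + b * c' l"])
      (simp add: sum_distrib_left sum.distrib algebra_simps)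
qed

lemma spanned_cong:
  "spanned A L v f \<Longrightarrow> (\<And>i. i \<in> A \<Longrightarrow> g i = f i) \<Longrightarrow> spanned A L v g"
  by (rule spanned_combine[where a = 1 and b = 0 and g = f]) auto

text \<open>Isolating the coefficient of one generator permits induction on the generating family.
  Since \<open>l\<close> is fresh, its coefficient can be set without disturbing the others.\<close>

lemma spanned_insert:
  assumes "finite L" "l \<notin> L"
  shows "spanned A (insert l L) v f \<longleftrightarrow> (\<exists>c. spanned A L v (\<lambda>i. f i - c * v l i))"
proof
  assume "spanned A (insert l L) v f"
  then obtain c where "\<forall>i\<in>A. f i = c l * v l i + (\<Sum>l\<in>L. c l * v l i)"
    using assms by (auto simp: spanned_def)
  then show "\<exists>c. spanned A L v (\<lambda>i. f i - c * v l i)"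
    unfolding spanned_def by (intro exI[of _ "c l"] exI[of _ c]) auto
next
  assume "\<exists>c. spanned A L v (\<lambda>i. f i - c * v l i)"
  then obtain c c' where c: "\<forall>i\<in>A. f i - c' * v l i = (\<Sum>l\<in>L. c l * v l i)"
    by (auto simp: spanned_def)
  have *: "(\<Sum>k\<in>L. (c(l := c')) k * v k i) = (\<Sum>k\<in>L. c k * v k i)" for i
    using assms by (intro sum.cong) auto
  show "spanned A (insert l L) v f"
    unfolding spanned_def
    by (rule exI[of _ "c(l := c')"]) (use assms c * in \<open>auto simp: algebra_simps\<close>)
qed

section \<open>Orthonormal families: Gram-Schmidt, Bessel, dimension bounds\<close>

lemma orthonormal_coeff:
  assumes "orthonormal A m e" "j < m"
  shows "dot A (e j) (\<lambda>i. \<Sum>k<m. c k * e k i) = c j"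
proof -
  have "(\<Sum>k<m. c k * dot A (e j) (e k)) = (\<Sum>k<m. if j = k then c k else 0)"
    using assms by (intro sum.cong) (auto simp: orthonormal_def)
  then show ?thesis
    using assms(2) by (simp add: dot_sum_right sum.delta')
qed

text \<open>Gram-Schmidt by induction on the generating family: the residual \<open>w\<close> of the
  new generator is normalized and appended, or dropped if it vanishes on \<open>A\<close>. Hence
  \<open>m\<close> can be smaller than \<open>card L\<close>.\<close>

lemma orthonormal_basis:
  fixes v :: "'b \<Rightarrow> 'a \<Rightarrow> real"
  assumes "finite L" "finite A"
  shows "\<exists>m e. m \<le> card L \<and> orthonormal A m e \<and> (\<forall>f. spanned A {..<m} e f \<longleftrightarrow> spanned A L v f)"
  using assms(1)
proof induction
  case empty
  show ?case by (intro exI[of _ 0]) (auto simp: orthonormal_def spanned_def)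
next
  case (insert l L)
  then obtain m e where m: "m \<le> card L" and e: "orthonormal A m e"
    and span: "\<And>f. spanned A {..<m} e f \<longleftrightarrow> spanned A L v f" by blast
  define p where "p i = (\<Sum>j<m. dot A (e j) (v l) * e j i)" for i
  define w where "w i = v l i - p i" for i
  have p: "spanned A {..<m} e p" by (auto simp: spanned_def p_def)
  have w_orth: "dot A (e j) w = 0" if "j < m" for j
    unfolding w_def dot_diff_right unfolding p_def using orthonormal_coeff[OF e that] by simp
  have ins: "spanned A (insert l L) v f \<longleftrightarrow> (\<exists>c. spanned A {..<m} e (\<lambda>i. f i - c * v l i))" for f
    using spanned_insert[OF insert.hyps] span by simp
  \<comment> \<open>The generator \<open>v l\<close> and its residual \<open>w\<close> differ by
    \<open>p\<close>, which is already in the span, so either may serve as the new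
    direction.\<close>
  have w_iff: "(\<exists>c. spanned A {..<m} e (\<lambda>i. f i - c * v l i)) \<longleftrightarrow> (\<exists>c. spanned A {..<m} e (\<lambda>i. f i - c * w i))" for f
  proof (intro iffI; elim exE)
    fix c assume "spanned A {..<m} e (\<lambda>i. f i - c * v l i)"
    from spanned_combine[OF this p, of "\<lambda>i. f i - c * w i" 1 c]
    show "\<exists>c. spanned A {..<m} e (\<lambda>i. f i - c * w i)" by (auto simp: w_def algebra_simps)
  next
    fix c assume "spanned A {..<m} e (\<lambda>i. f i - c * w i)"
    from spanned_combine[OF this p, of "\<lambda>i. f i - c * v l i" 1 "-c"]
    show "\<exists>c. spanned A {..<m} e (\<lambda>i. f i - c * v l i)" by (auto simp: w_def algebra_simps)
  qed
  show ?case
  proof (cases "dot A w w = 0")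
    case True
    then have w0: "\<And>i. i \<in> A \<Longrightarrow> w i = 0" using dot_self_eq_0[OF assms(2)] by blast
    have "(\<exists>c. spanned A {..<m} e (\<lambda>i. f i - c * w i)) \<longleftrightarrow> spanned A {..<m} e f" for f
      using w0 spanned_cong[of A "{..<m}" e] by auto
    with m e ins w_iff show ?thesis
      using insert.hyps by (intro exI[of _ m] exI[of _ e]) auto
  next
    case False
    define s where "s = sqrt (dot A w w)"
    have s: "s > 0" "s * s = dot A w w"
      using False dot_self_nonneg[of A w] by (auto simp: s_def less_le)
    define e' where "e' = e(m := (\<lambda>i. inverse s * w i))"
    have e'm: "e' m = (\<lambda>i. inverse s * w i)" by (simp add: e'_def)
    have e'j: "e' j = e j" if "j < m" for j using that by (simp add: e'_def)
    have mm: "dot A (e' m) (e' m) = 1"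
      using s False unfolding e'm dot_scale_left dot_scale_right by (simp add: field_simps)
    have jm: "dot A (e' j) (e' m) = 0" if "j < m" for j
      using w_orth[OF that] that unfolding e'm dot_scale_right by (simp add: e'j)
    have "orthonormal A (Suc m) e'"
      unfolding orthonormal_def
    proof (intro allI impI)
      fix j k assume "j < Suc m" "k < Suc m"
      then consider "j < m" "k < m" | "j < m" "k = m" | "j = m" "k < m" | "j = m" "k = m" by linarith
      then show "dot A (e' j) (e' k) = (if j = k then 1 else 0)"
        using e mm jm by cases (auto simp: e'j orthonormal_def, metis dot_commute e'j)
    qed
    moreover have "spanned A {..<Suc m} e' f \<longleftrightarrow> spanned A (insert l L) v f" for f
    proof -
      have "spanned A {..<Suc m} e' f \<longleftrightarrow> (\<exists>c. spanned A {..<m} e' (\<lambda>i. f i - c * e' m i))"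
        unfolding lessThan_Suc by (rule spanned_insert) auto
      also have "\<dots> \<longleftrightarrow> (\<exists>c. spanned A {..<m} e (\<lambda>i. f i - c * e' m i))"
        by (simp add: spanned_def e'j)
      also have "\<dots> \<longleftrightarrow> (\<exists>c. spanned A {..<m} e (\<lambda>i. f i - c * w i))"
      proof (intro iffI; elim exE)
        fix c assume "spanned A {..<m} e (\<lambda>i. f i - c * e' m i)"
        then show "\<exists>c. spanned A {..<m} e (\<lambda>i. f i - c * w i)"
          by (intro exI[of _ "c * inverse s"]) (simp add: e'm mult.assoc)
      next
        fix c assume "spanned A {..<m} e (\<lambda>i. f i - c * w i)"
        then show "\<exists>c. spanned A {..<m} e (\<lambda>i. f i - c * e' m i)"
          using s by (intro exI[of _ "c * s"]) (simp add: e'm mult.assoc field_simps)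
      qed
      finally show ?thesis using ins w_iff by simp
    qed
    ultimately show ?thesis
      using m insert.hyps by (intro exI[of _ "Suc m"] exI[of _ e']) auto
  qed
qed

text \<open>For the projection f of z, both \<langle>z, f\<rangle> and \<langle>f, f\<rangle> equal
  the left side s. Cauchy-Schwarz then gives s * s \<le> \<langle>z, z\<rangle> * s, and s can be
  cancelled unless it is 0.\<close>

lemma orthonormal_Bessel:
  assumes "orthonormal A m e"
  shows "(\<Sum>j<m. (dot A z (e j))\<^sup>2) \<le> dot A z z"
proof -
  define f where "f = (\<lambda>i. \<Sum>j<m. dot A z (e j) * e j i)"
  define s where "s = (\<Sum>j<m. (dot A z (e j))\<^sup>2)"
  have zf: "dot A z f = s"
    unfolding f_def dot_sum_right by (simp add: s_def power2_eq_square)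
  have "dot A f f = (\<Sum>j<m. dot A z (e j) * dot A f (e j))"
    by (subst (2) f_def) (simp add: dot_sum_right)
  also have "\<dots> = s"
    unfolding s_def power2_eq_square
  proof (intro sum.cong refl)
    fix j assume "j \<in> {..<m}"
    then show "dot A z (e j) * dot A f (e j) = dot A z (e j) * dot A z (e j)"
      using orthonormal_coeff[OF assms, of j "\<lambda>j. dot A z (e j)", folded f_def]
      by (simp add: dot_commute[of A f])
  qed
  finally have "s * s \<le> dot A z z * s"
    using dot_Cauchy_Schwarz[of A z f] zf by (simp add: power2_eq_square)
  moreover have "s \<ge> 0" by (simp add: s_def sum_nonneg)
  ultimately show ?thesis
    using dot_self_nonneg[of A z] unfolding s_def[symmetric] by (cases "s = 0") auto
qed

text \<open>Double counting: the squared entries of the family sum to \<open>m\<close>, while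
  Bessel's inequality for a coordinate vector bounds the contribution of each index by 1.\<close>

lemma orthonormal_card_le:
  assumes "orthonormal A m e" "finite A"
  shows "m \<le> card A"
proof -
  have "real m = (\<Sum>j<m. dot A (e j) (e j))"
    using assms by (simp add: orthonormal_def)
  also have "\<dots> = (\<Sum>i\<in>A. \<Sum>j<m. (e j i)\<^sup>2)"
    unfolding dot_def by (subst sum.swap) (simp add: power2_eq_square)
  also have "\<dots> \<le> (\<Sum>i\<in>A. 1)"
  proof (rule sum_mono)
    fix i assume i: "i \<in> A"
    have *: "dot A (\<lambda>k. if k = i then 1 else 0) f = f i" for f
      using i assms(2) by (simp add: dot_def if_distrib[of "\<lambda>x. x * _"] cong: if_cong)
    show "(\<Sum>j<m. (e j i)\<^sup>2) \<le> 1"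
      using orthonormal_Bessel[OF assms(1), of "\<lambda>k. if k = i then 1 else 0"] by (simp add: *)
  qed
  finally show ?thesis by simp
qed

text \<open>A vector \<open>u\<close> of the span sees only the projection of \<open>z\<close>, so
  Cauchy-Schwarz is applied to the coefficient vectors and not to \<open>u\<close> and
  \<open>z\<close> themselves.\<close>

lemma dot_spanned_le:
  assumes "orthonormal A m e" "spanned A {..<m} e u"
  shows "(dot A z u)\<^sup>2 \<le> dot A u u * (\<Sum>j<m. (dot A z (e j))\<^sup>2)"
proof -
  from assms(2) obtain c where c: "\<forall>i\<in>A. u i = (\<Sum>j<m. c j * e j i)" by (auto simp: spanned_def)
  have eq: "dot A g u = (\<Sum>j<m. c j * dot A g (e j))" for g
    using c dot_cong[of A g g u "\<lambda>i. \<Sum>j<m. c j * e j i"] by (simp add: dot_sum_right)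
  have "dot A u (e j) = c j" if "j < m" for j
    using orthonormal_coeff[OF assms(1) that, of c] c
      dot_cong[of A "e j" "e j" u "\<lambda>i. \<Sum>j<m. c j * e j i"] by (simp add: dot_commute[of A u])
  then have uu: "dot A u u = (\<Sum>j<m. (c j)\<^sup>2)"
    by (simp add: eq power2_eq_square)
  show ?thesis unfolding uu eq[of z] by (rule Cauchy_Schwarz_ineq_sum)
qed

text \<open>
  With \<open>W\<close> the squared length of the projection of the noise \<open>z\<close>, the cross term satisfies
  \<open>2 \<sigma> \<langle>z, p - t\<rangle> \<le> 2 \<sigma>\<^sup>2 W / \<delta> + \<delta> \<parallel>p - t\<parallel>\<^sup>2 / 2\<close>.
\<close>

lemma penalized_oracle_inequality:
  fixes \<sigma> \<delta> :: real
  assumes e: "orthonormal A m e" and span: "spanned A {..<m} e (\<lambda>i. p i - t i)"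
    and y: "\<And>i. i \<in> A \<Longrightarrow> y i = s i + \<sigma> * z i" and \<delta>: "\<delta> > 0"
    and opt: "dot A (\<lambda>i. y i - p i) (\<lambda>i. y i - p i) + K' \<le> dot A (\<lambda>i. y i - t i) (\<lambda>i. y i - t i) + K"
  shows "(1 - \<delta>) * dot A (\<lambda>i. p i - s i) (\<lambda>i. p i - s i)
    \<le> (1 + \<delta>) * dot A (\<lambda>i. t i - s i) (\<lambda>i. t i - s i) + K
      + (2 * \<sigma>\<^sup>2 / \<delta> * (\<Sum>j<m. (dot A z (e j))\<^sup>2) - K')"
proof -
  define W where "W = (\<Sum>j<m. (dot A z (e j))\<^sup>2)"
  define D where "D = dot A (\<lambda>i. p i - t i) (\<lambda>i. p i - t i)"
  define x where "x = dot A z (\<lambda>i. p i - t i)"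
  \<comment> \<open>Expanding around \<open>s\<close> leaves two terms that do not involve
    \<open>q\<close>; they cancel when the residuals of \<open>p\<close> and \<open>t\<close> are
    compared.\<close>
  have expand: "dot A (\<lambda>i. y i - q i) (\<lambda>i. y i - q i)
      = dot A (\<lambda>i. q i - s i) (\<lambda>i. q i - s i) + 2 * \<sigma> * (dot A z s - dot A z q) + \<sigma>\<^sup>2 * dot A z z" for q
    unfolding dot_def sum_distrib_left sum_subtractf[symmetric] sum.distrib[symmetric]
    by (intro sum.cong refl) (simp add: y power2_eq_square algebra_simps)
  have W: "W \<ge> 0" by (simp add: W_def sum_nonneg)
  have "x\<^sup>2 \<le> D * W"
    using dot_spanned_le[OF e span] by (simp add: x_def D_def W_def)
  then have "\<bar>x\<bar> \<le> sqrt D * sqrt W"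
    by (metis real_sqrt_abs real_sqrt_le_iff real_sqrt_mult)
  then have "2 * \<sigma> * x \<le> 2 * (\<bar>\<sigma>\<bar> * (sqrt D * sqrt W))"
  proof -
    assume *: "\<bar>x\<bar> \<le> sqrt D * sqrt W"
    have "\<sigma> * x \<le> \<bar>\<sigma>\<bar> * \<bar>x\<bar>" by (metis abs_ge_self abs_mult)
    also have "\<dots> \<le> \<bar>\<sigma>\<bar> * (sqrt D * sqrt W)" using * by (rule mult_left_mono) simp
    finally show ?thesis by simp
  qed
  \<comment> \<open>Weighted arithmetic-geometric mean inequality: expand the square below and
    divide by 2 * \<delta>.\<close>
  also have "\<dots> \<le> \<delta> / 2 * D + 2 * \<sigma>\<^sup>2 / \<delta> * W"
  proof -
    have "0 \<le> (\<delta> * sqrt D - 2 * \<bar>\<sigma>\<bar> * sqrt W)\<^sup>2" by simp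
    also have "\<dots> = \<delta>\<^sup>2 * D - 4 * \<delta> * (\<bar>\<sigma>\<bar> * (sqrt D * sqrt W)) + 4 * \<sigma>\<^sup>2 * W"
      using W dot_self_nonneg[of A "\<lambda>i. p i - t i"]
      by (simp add: power2_diff power_mult_distrib D_def[symmetric])
    finally show ?thesis using \<delta> by (simp add: field_simps power2_eq_square)
  qed
  finally have x: "2 * \<sigma> * x \<le> \<delta> / 2 * D + 2 * \<sigma>\<^sup>2 / \<delta> * W" .
  have D: "D \<le> 2 * dot A (\<lambda>i. p i - s i) (\<lambda>i. p i - s i) + 2 * dot A (\<lambda>i. t i - s i) (\<lambda>i. t i - s i)"
    unfolding D_def by (rule dot_self_diff_le)
  \<comment> \<open>Splitting \<open>D\<close> at \<open>s\<close> costs \<delta> times each squared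
    distance. This produces the factor 1 - \<delta> on the left of the claim and 1 + \<delta> on the
    right.\<close>
  have "\<delta> / 2 * D \<le> \<delta> * dot A (\<lambda>i. p i - s i) (\<lambda>i. p i - s i) + \<delta> * dot A (\<lambda>i. t i - s i) (\<lambda>i. t i - s i)"
    using mult_left_mono[OF D, of "\<delta> / 2"] \<delta> by (simp add: algebra_simps)
  moreover have "2 * \<sigma> * x = 2 * \<sigma> * dot A z p - 2 * \<sigma> * dot A z t"
    by (simp add: x_def dot_diff_right algebra_simps)
  ultimately show ?thesis
    using opt x unfolding expand W_def[symmetric] by (simp add: algebra_simps)
qed

section \<open>Gaussian moment generating functions\<close>

definition std_normal :: "real measure" where
  "std_normal = density lborel (\<lambda>x. ennreal (std_normal_density x))"

lemma sets_std_normal [measurable_cong, simp]: "sets std_normal = sets borel"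
  and space_std_normal [simp]: "space std_normal = UNIV"
  by (simp_all add: std_normal_def)

lemma prob_space_std_normal: "prob_space std_normal"
  unfolding std_normal_def by (rule prob_space_normal_density) simp

lemma nn_integral_normal_density: "0 < \<sigma> \<Longrightarrow> (\<integral>\<^sup>+x. ennreal (normal_density \<mu> \<sigma> x) \<partial>lborel) = 1"
  by (subst nn_integral_eq_integral) (auto simp: integrable_normal_density integral_normal_density)

text \<open>Completing the square turns the integrand into a constant multiple of the normal density
  with mean \<open>s\<close> and variance 1.\<close>

lemma std_normal_mgf: "(\<integral>\<^sup>+x. ennreal (exp (s * x)) \<partial>std_normal) = ennreal (exp (s\<^sup>2 / 2))"
proof -
  have "std_normal_density x * exp (s * x) = exp (s\<^sup>2 / 2) * normal_density s 1 x" for x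
    by (simp add: normal_density_def exp_add[symmetric] power2_eq_square field_simps)
  then have "(\<integral>\<^sup>+x. ennreal (exp (s * x)) \<partial>std_normal)
      = (\<integral>\<^sup>+x. ennreal (exp (s\<^sup>2 / 2)) * ennreal (normal_density s 1 x) \<partial>lborel)"
    by (simp add: std_normal_def nn_integral_density ennreal_mult[symmetric])
  then show ?thesis by (simp add: nn_integral_cmult nn_integral_normal_density)
qed

text \<open>The weight leaves the exponent - x * x / 4, that of a centred normal density with
  variance 2; the ratio of the normalizing constants is \<open>sqrt 2\<close>.\<close>

lemma std_normal_square_mgf: "(\<integral>\<^sup>+x. ennreal (exp (x\<^sup>2 / 4)) \<partial>std_normal) = ennreal (sqrt 2)"
proof -
  have "std_normal_density x * exp (x\<^sup>2 / 4) = sqrt 2 * normal_density 0 (sqrt 2) x" for x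
    by (simp add: normal_density_def exp_add[symmetric] real_sqrt_mult field_simps)
  then have "(\<integral>\<^sup>+x. ennreal (exp (x\<^sup>2 / 4)) \<partial>std_normal)
      = (\<integral>\<^sup>+x. ennreal (sqrt 2) * ennreal (normal_density 0 (sqrt 2) x) \<partial>lborel)"
    by (simp add: std_normal_def nn_integral_density ennreal_mult[symmetric])
  then show ?thesis by (simp add: nn_integral_cmult nn_integral_normal_density)
qed

section \<open>Gaussian vectors\<close>

lemma product_sigma_finite_std_normal: "product_sigma_finite (\<lambda>_. std_normal)"
  by (simp add: product_sigma_finite_def prob_space_imp_sigma_finite prob_space_std_normal)

lemma nn_integral_PiM_std_normal_exp_sum:
  fixes f :: "'a \<Rightarrow> real \<Rightarrow> real"
  assumes "finite I" and [measurable]: "\<And>i. f i \<in> borel_measurable borel"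
  shows "(\<integral>\<^sup>+x. ennreal (exp (\<Sum>i\<in>I. f i (x i))) \<partial>PiM I (\<lambda>_. std_normal))
    = (\<Prod>i\<in>I. \<integral>\<^sup>+x. ennreal (exp (f i x)) \<partial>std_normal)"
proof -
  interpret product_sigma_finite "\<lambda>_. std_normal" by (rule product_sigma_finite_std_normal)
  have "(\<integral>\<^sup>+x. ennreal (exp (\<Sum>i\<in>I. f i (x i))) \<partial>PiM I (\<lambda>_. std_normal))
      = (\<integral>\<^sup>+x. (\<Prod>i\<in>I. ennreal (exp (f i (x i)))) \<partial>PiM I (\<lambda>_. std_normal))"
    using assms(1) by (simp add: exp_sum prod_ennreal)
  also have "\<dots> = (\<Prod>i\<in>I. \<integral>\<^sup>+x. ennreal (exp (f i x)) \<partial>std_normal)"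
    using assms(1) by (rule product_nn_integral_prod) measurable
  finally show ?thesis .
qed

lemma nn_integral_PiM_std_normal_exp_dot:
  assumes "finite I"
  shows "(\<integral>\<^sup>+x. ennreal (exp (dot I x v)) \<partial>PiM I (\<lambda>_. std_normal)) = ennreal (exp (dot I v v / 2))"
proof -
  have "(\<integral>\<^sup>+x. ennreal (exp (dot I x v)) \<partial>PiM I (\<lambda>_. std_normal))
      = (\<Prod>i\<in>I. \<integral>\<^sup>+x. ennreal (exp (v i * x)) \<partial>std_normal)"
    using nn_integral_PiM_std_normal_exp_sum[OF assms, of "\<lambda>i x. v i * x"]
    by (simp add: dot_def mult.commute)
  also have "\<dots> = ennreal (exp (dot I v v / 2))"
    using assms by (simp add: std_normal_mgf prod_ennreal exp_sum dot_def power2_eq_square sum_divide_distrib)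
  finally show ?thesis .
qed

text \<open>
  Instead of rotation invariance, the square is linearized by an auxiliary Gaussian vector \<open>g\<close>:
  \<open>exp (\<parallel>w\<parallel>\<^sup>2 / 4) = E exp (\<langle>g, w\<rangle> / \<surd>2)\<close>, and then the order of integration is exchanged.
\<close>

lemma nn_integral_exp_projected_noise:
  assumes A: "finite A" and e: "orthonormal A m e"
  shows "(\<integral>\<^sup>+z. ennreal (exp ((\<Sum>j<m. (dot A z (e j))\<^sup>2) / 4)) \<partial>PiM A (\<lambda>_. std_normal))
    = ennreal (sqrt 2 ^ m)"
proof -
  let ?Z = "PiM A (\<lambda>_. std_normal)" and ?G = "PiM {..<m} (\<lambda>_::nat. std_normal)"
  interpret Z: prob_space ?Z by (intro prob_space_PiM prob_space_std_normal)
  interpret G: prob_space ?G by (intro prob_space_PiM prob_space_std_normal)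
  interpret pair_sigma_finite ?Z ?G ..
  \<comment> \<open>The adjoint of taking coefficients: pairing the auxiliary vector
    \<open>g\<close> with the scaled coefficients of \<open>z\<close> equals pairing
    \<open>z\<close> with \<open>v g\<close>.\<close>
  define v where "v g = (\<lambda>i. \<Sum>j<m. g j / sqrt 2 * e j i)" for g
  have *: "dot {..<m} g (\<lambda>j. dot A z (e j) / sqrt 2) = dot A z (v g)" for g z
    unfolding v_def dot_sum_right by (simp add: dot_def)
  have [measurable]: "(\<lambda>(z, g). ennreal (exp (dot A z (v g)))) \<in> borel_measurable (?Z \<Otimes>\<^sub>M ?G)"
    unfolding dot_def v_def by measurable
  have lin: "ennreal (exp ((\<Sum>j<m. (dot A z (e j))\<^sup>2) / 4)) = (\<integral>\<^sup>+g. ennreal (exp (dot A z (v g))) \<partial>?G)" for z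
    unfolding *[symmetric]
    by (subst nn_integral_PiM_std_normal_exp_dot)
      (simp_all add: dot_def[of "{..<m}"] power2_eq_square sum_divide_distrib)
  \<comment> \<open>By orthonormality \<open>v\<close> is an isometry up to the factor 1 /
    \<open>sqrt 2\<close>, which makes the exponent a sum over independent coordinates.\<close>
  have vv: "dot A (v g) (v g) / 2 = (\<Sum>j<m. (g j)\<^sup>2 / 4)" for g
  proof -
    have "dot A (v g) (v g) = (\<Sum>j<m. g j / sqrt 2 * dot A (v g) (e j))"
      by (subst (2) v_def, rule dot_sum_right)
    also have "\<dots> = (\<Sum>j<m. g j / sqrt 2 * (g j / sqrt 2))"
    proof (intro sum.cong refl)
      fix j assume "j \<in> {..<m}"
      then show "g j / sqrt 2 * dot A (v g) (e j) = g j / sqrt 2 * (g j / sqrt 2)"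
        using orthonormal_coeff[OF e, of j "\<lambda>j. g j / sqrt 2", folded v_def]
        by (simp add: dot_commute[of A "v g"])
    qed
    finally show ?thesis by (simp add: power2_eq_square sum_divide_distrib)
  qed
  have "(\<integral>\<^sup>+z. ennreal (exp ((\<Sum>j<m. (dot A z (e j))\<^sup>2) / 4)) \<partial>?Z)
      = (\<integral>\<^sup>+g. (\<integral>\<^sup>+z. ennreal (exp (dot A z (v g))) \<partial>?Z) \<partial>?G)"
    unfolding lin by (rule Fubini'[symmetric]) measurable
  also have "\<dots> = (\<integral>\<^sup>+g. ennreal (exp (\<Sum>j<m. (g j)\<^sup>2 / 4)) \<partial>?G)"
    using A by (simp add: nn_integral_PiM_std_normal_exp_dot vv)
  also have "\<dots> = ennreal (sqrt 2 ^ m)"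
    using nn_integral_PiM_std_normal_exp_sum[of "{..<m}" "\<lambda>_ x. x\<^sup>2 / 4"]
    by (simp add: std_normal_square_mgf ennreal_power)
  finally show ?thesis .
qed

section \<open>Rectangular partitions and piecewise polynomials\<close>

lemma finite_grid [simp]: "finite (grid d n)"
  by (simp add: grid_def finite_PiE)

lemma card_grid: "card (grid d n) = n ^ d"
  by (simp add: grid_def card_PiE)

lemma box_nonempty_iff: "box d a b \<noteq> {} \<longleftrightarrow> (\<forall>j\<in>{1..d}. a j \<le> b j)"
  by (auto simp: box_def PiE_eq_empty_iff)

lemma box_cong: "(\<And>j. j \<in> {1..d} \<Longrightarrow> a j = a' j \<and> b j = b' j) \<Longrightarrow> box d a b = box d a' b'"
  unfolding box_def by (intro PiE_cong) simp

text \<open>A nonempty box contains its lowest and highest corners, which are therefore grid points.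
  Restricting them to the coordinates in use makes them extensional without changing the
  box.\<close>

lemma rectangles_subset: "{R. rectangle d n R} \<subseteq> (\<lambda>(a, b). box d a b) ` (grid d n \<times> grid d n)"
proof
  fix R assume "R \<in> {R. rectangle d n R}"
  then obtain a b where R: "R = box d a b" "R \<noteq> {}" "R \<subseteq> grid d n" by (auto simp: rectangle_def)
  then have le: "\<forall>j\<in>{1..d}. a j \<le> b j" by (simp add: box_nonempty_iff)
  have "restrict a {1..d} \<in> R" "restrict b {1..d} \<in> R"
    using le by (auto simp: R(1) box_def)
  moreover have "R = box d (restrict a {1..d}) (restrict b {1..d})"
    unfolding R(1) by (rule box_cong) simp
  ultimately show "R \<in> (\<lambda>(a, b). box d a b) ` (grid d n \<times> grid d n)"
    using R(3) by blast
qed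

lemma finite_rectangles: "finite {R. rectangle d n R}"
  by (rule finite_subset[OF rectangles_subset]) simp

lemma card_rectangles: "card {R. rectangle d n R} \<le> (n ^ d)\<^sup>2"
proof -
  have "card {R. rectangle d n R} \<le> card (grid d n \<times> grid d n)"
    by (rule surj_card_le[OF _ rectangles_subset]) simp
  then show ?thesis by (simp add: card_cartesian_product card_grid power2_eq_square)
qed

lemma all_partitions_subset: "all_partitions d n \<subseteq> Pow {R. rectangle d n R}"
  by (auto simp: all_partitions_def)

lemma finite_all_partitions: "finite (all_partitions d n)"
  by (rule finite_subset[OF all_partitions_subset]) (simp add: finite_rectangles)

lemma all_partitionsD:
  assumes "P \<in> all_partitions d n"
  shows "partition_on (grid d n) P" "finite P" "\<And>R. R \<in> P \<Longrightarrow> rectangle d n R"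
proof -
  from assms show "partition_on (grid d n) P" "\<And>R. R \<in> P \<Longrightarrow> rectangle d n R"
    by (auto simp: all_partitions_def)
  from assms all_partitions_subset show "finite P"
    by (blast intro: finite_subset[OF _ finite_rectangles])
qed

section \<open>Splits and the inclusions between the partition classes\<close>

lemma whole_all_partitions:
  assumes "n \<ge> 1"
  shows "{grid d n} \<in> all_partitions d n"
proof -
  have "grid d n \<noteq> {}" using assms by (auto simp: grid_def PiE_eq_empty_iff)
  moreover have "grid d n = box d (\<lambda>_. 1) (\<lambda>_. n)" by (simp add: grid_def box_def)
  ultimately show ?thesis
    by (auto simp: all_partitions_def rectangle_def intro!: partition_on_space)
qed

text \<open>The two halves consist of the points of the box whose coordinate \<open>j\<close> is at
  most \<open>l\<close>, respectively greater than \<open>l\<close>.\<close>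

lemma box_split:
  assumes "j \<in> {1..d}" "a j \<le> l" "l < b j"
  shows "box d a (b(j := l)) \<union> box d (a(j := l + 1)) b = box d a b"
    and "box d a (b(j := l)) \<inter> box d (a(j := l + 1)) b = {}"
    and "box d a b \<noteq> {} \<Longrightarrow> box d a (b(j := l)) \<noteq> {}"
    and "box d a b \<noteq> {} \<Longrightarrow> box d (a(j := l + 1)) b \<noteq> {}"
proof -
  have mem: "f \<in> box d a' b' \<longleftrightarrow> f \<in> extensional {1..d} \<and> (a' j \<le> f j \<and> f j \<le> b' j)
      \<and> (\<forall>k\<in>{1..d} - {j}. a' k \<le> f k \<and> f k \<le> b' k)" for f a' b'
  proof -
    have "(\<forall>k\<in>{1..d}. Q k) \<longleftrightarrow> Q j \<and> (\<forall>k\<in>{1..d} - {j}. Q k)" for Q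
      using assms(1) by blast
    from this[of "\<lambda>k. a' k \<le> f k \<and> f k \<le> b' k"] show ?thesis
      by (simp add: box_def PiE_iff conj_commute)
  qed
  have lower: "f \<in> box d a (b(j := l)) \<longleftrightarrow> f \<in> box d a b \<and> f j \<le> l" for f
    unfolding mem using assms(3) by (auto cong: ball_cong)
  have upper: "f \<in> box d (a(j := l + 1)) b \<longleftrightarrow> f \<in> box d a b \<and> l < f j" for f
    unfolding mem using assms(2) by (auto cong: ball_cong)
  show "box d a (b(j := l)) \<union> box d (a(j := l + 1)) b = box d a b"
    using lower upper by fastforce
  show "box d a (b(j := l)) \<inter> box d (a(j := l + 1)) b = {}"
    using lower upper by fastforce
qed (use assms in \<open>auto simp: box_nonempty_iff\<close>)

text \<open>Both halves are nonempty and lie in the removed box, so they are disjoint from the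
  remaining pieces and new. The exact increase in cardinality serves the maximality argument for
  dyadic partitions.\<close>

lemma split_all_partitions:
  assumes P: "P \<in> all_partitions d n" and B: "box d a b \<in> P"
    and j: "j \<in> {1..d}" "a j \<le> l" "l < b j"
  defines "Q \<equiv> (P - {box d a b}) \<union> {box d a (b(j := l)), box d (a(j := l + 1)) b}"
  shows "Q \<in> all_partitions d n" and "card Q = Suc (card P)"
proof -
  let ?B = "box d a b" and ?B1 = "box d a (b(j := l))" and ?B2 = "box d (a(j := l + 1)) b"
  note P' = all_partitionsD[OF P]
  have ne: "?B \<noteq> {}" and sub: "?B \<subseteq> grid d n" using P'(3)[OF B] by (auto simp: rectangle_def)
  note split = box_split[where d = d and a = a and b = b, OF j] 
  have B12: "?B1 \<noteq> {}" "?B2 \<noteq> {}" using split(3,4) ne by auto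
  have dis: "disjnt R ?B" if "R \<in> P - {?B}" for R
    using partition_onD2[OF P'(1)] B that by (auto simp: disjoint_def disjnt_def)
  have dis12: "disjnt R ?B1" "disjnt R ?B2" if "R \<in> P - {?B}" for R
    using dis[OF that] split(1) by (auto simp: disjnt_def)
  have new: "?B1 \<notin> P - {?B}" "?B2 \<notin> P - {?B}" "?B1 \<noteq> ?B2"
    using dis12 B12 split(2) by (auto simp: disjnt_def)
  have "partition_on (grid d n) Q"
  proof (rule partition_onI)
    have "\<Union>Q = \<Union>(P - {?B}) \<union> (?B1 \<union> ?B2)" by (auto simp: Q_def)
    also have "\<dots> = \<Union>P" unfolding split(1) using B by auto
    finally show "\<Union>Q = grid d n" using partition_onD1[OF P'(1)] by simp
    show "{} \<notin> Q" using B12 partition_onD3[OF P'(1)] by (auto simp: Q_def)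
    fix R R' assume "R \<in> Q" "R' \<in> Q" "R \<noteq> R'"
    then consider "R \<in> P" "R' \<in> P" | "R \<in> P - {?B}" "R' \<in> {?B1, ?B2}"
      | "R \<in> {?B1, ?B2}" "R' \<in> P - {?B}" | "R \<in> {?B1, ?B2}" "R' \<in> {?B1, ?B2}"
      unfolding Q_def by auto
    then show "disjnt R R'"
    proof cases
      case 1
      then show ?thesis
        using partition_onD2[OF P'(1)] \<open>R \<noteq> R'\<close> by (auto simp: disjoint_def disjnt_def)
    next
      case 2
      then show ?thesis using dis12[OF 2(1)] by auto
    next
      case 3
      then show ?thesis using dis12[OF 3(2)] by (auto simp: disjnt_sym)
    next
      case 4
      then show ?thesis using split(2) \<open>R \<noteq> R'\<close> by (auto simp: disjnt_def)
    qed
  qed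
  moreover have "rectangle d n ?B1" "rectangle d n ?B2"
    using B12 sub split(1) by (auto simp: rectangle_def)
  ultimately show "Q \<in> all_partitions d n"
    using P'(3) by (auto simp: all_partitions_def Q_def)
  have "card Q = card (P - {?B}) + 2"
    unfolding Q_def using P'(2) new by (subst card_Un_disjoint) auto
  then show "card Q = Suc (card P)"
    using P'(2) B card_gt_0_iff[of P] by (auto simp: card_Diff_singleton_if)
qed

lemma hier_subset_all:
  assumes "n \<ge> 1"
  shows "hier_partitions d n \<subseteq> all_partitions d n"
proof
  fix P assume "P \<in> hier_partitions d n"
  then show "P \<in> all_partitions d n"
    by induction (use whole_all_partitions[OF assms] split_all_partitions(1) in auto)
qed

text \<open>The length b - a + 1 is at least 2, so its rounded-up half lies between 1 and b - a.
  Thus a dyadic split is an admissible hierarchical one.\<close>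

lemma dyadic_split_bounds:
  fixes l a b :: nat
  assumes "a < b" "int l = int a - 1 + \<lceil>(real b - real a + 1) / 2\<rceil>"
  shows "a \<le> l" "l < b"
proof -
  have "1 \<le> \<lceil>(real b - real a + 1) / 2\<rceil>" using assms(1) by (simp add: le_ceiling_iff)
  then show "a \<le> l" using assms(2) by linarith
  have "\<lceil>(real b - real a + 1) / 2\<rceil> \<le> int b - int a"
    using assms(1) by (simp add: ceiling_le_iff)
  then show "l < b" using assms(2) by linarith
qed

lemma rdp_subset_hier: "rdp_partitions d n \<subseteq> hier_partitions d n"
proof
  fix P assume "P \<in> rdp_partitions d n"
  then show "P \<in> hier_partitions d n"
  proof induction
    case (split P a b j l)
    then show ?case using dyadic_split_bounds[of "a j" "b j" l] by (intro hier_partitions.split) auto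
  qed (rule hier_partitions.whole)
qed

text \<open>Makes one dyadic partition available as a competitor in all three classes.\<close>

lemma rdp_subset_partitions:
  assumes "n \<ge> 1"
  shows "rdp_partitions d n \<subseteq> partitions c d n"
  using rdp_subset_hier hier_subset_all[OF assms] by (cases c) force+

text \<open>Lets a single union bound over \<open>all_partitions\<close> treat all three classes at
  once.\<close>

lemma partitions_subset_all:
  assumes "n \<ge> 1"
  shows "partitions c d n \<subseteq> all_partitions d n"
  using rdp_subset_hier hier_subset_all[OF assms] by (cases c) force+

text \<open>A dyadic partition of maximal cardinality cannot be split further.\<close>

lemma singletons_in_rdp_partitions:
  assumes "n \<ge> 1"
  shows "\<exists>P\<in>rdp_partitions d n. \<forall>R\<in>P. \<exists>x. R = {x}"
proof -
  have sub: "rdp_partitions d n \<subseteq> all_partitions d n"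
    using rdp_subset_hier hier_subset_all[OF assms] by blast
  have fin: "finite (rdp_partitions d n)" by (rule finite_subset[OF sub finite_all_partitions])
  obtain P where P: "P \<in> rdp_partitions d n" and max: "\<And>Q. Q \<in> rdp_partitions d n \<Longrightarrow> card Q \<le> card P"
  proof -
    have "Max (card ` rdp_partitions d n) \<in> card ` rdp_partitions d n"
      using fin rdp_partitions.whole[of d n] by (intro Max_in) auto
    then obtain P where "P \<in> rdp_partitions d n" "card P = Max (card ` rdp_partitions d n)" by auto
    then show ?thesis using that[of P] fin by simp
  qed
  have "\<exists>x. R = {x}" if R: "R \<in> P" for R
  proof -
    obtain a b where ab: "R = box d a b" "box d a b \<noteq> {}"
      using all_partitionsD(3)[of P] P R sub unfolding rectangle_def by blast
    have "a j = b j" if j: "j \<in> {1..d}" for j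
    proof (rule ccontr)
      assume "a j \<noteq> b j"
      then have lt: "a j < b j" using ab(2) j by (auto simp: box_nonempty_iff le_less)
      \<comment> \<open>The conversion by \<open>nat\<close> loses nothing: the ceiling is at least
        1, so the integer is at least \<open>a j\<close>.\<close>
      define l where "l = nat (int (a j) - 1 + \<lceil>(real (b j) - real (a j) + 1) / 2\<rceil>)"
      have "1 \<le> \<lceil>(real (b j) - real (a j) + 1) / 2\<rceil>" using lt by (simp add: le_ceiling_iff)
      then have l: "int l = int (a j) - 1 + \<lceil>(real (b j) - real (a j) + 1) / 2\<rceil>"
        unfolding l_def by linarith
      note bounds = dyadic_split_bounds[OF lt l]
      from max[OF rdp_partitions.split[OF P R[unfolded ab(1)] j lt l]]
        split_all_partitions(2)[OF subsetD[OF sub P] R[unfolded ab(1)] j bounds]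
      show False by simp
    qed
    \<comment> \<open>A product of singletons consists of one extensional function, hence the
      restriction of \<open>a\<close>.\<close>
    then have "R = (\<Pi>\<^sub>E j\<in>{1..d}. {restrict a {1..d} j})"
      unfolding ab(1) box_def by (intro PiE_cong) simp
    then show ?thesis by (simp add: PiE_singleton del: restrict_apply)
  qed
  with P show ?thesis by blast
qed

section \<open>Piecewise polynomials as a finitely generated space\<close>

lemma finite_multi_indices: "finite (multi_indices d r)"
  unfolding multi_indices_def by (rule finite_subset[of _ "{1..d} \<rightarrow>\<^sub>E {0..r}"]) (auto simp: finite_PiE)

text \<open>Induction on \<open>d\<close>: fixing the last exponent \<open>k\<close> leaves total
  degree at most \<open>r - k\<close> for the others, and the hockey-stick identity sums the
  resulting binomials.\<close>

lemma card_multi_indices: "card (multi_indices d r) \<le> (r + d) choose d"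
proof (induction d arbitrary: r)
  case 0
  have "multi_indices 0 r \<subseteq> {\<lambda>_. undefined}" by (auto simp: multi_indices_def)
  from card_mono[OF _ this] show ?case by simp
next
  case (Suc d)
  have sub: "multi_indices (Suc d) r \<subseteq> (\<Union>k\<le>r. (\<lambda>\<alpha>. \<alpha>(Suc d := k)) ` multi_indices d (r - k))"
  proof
    fix \<alpha> assume \<alpha>: "\<alpha> \<in> multi_indices (Suc d) r"
    let ?\<beta> = "restrict \<alpha> {1..d}"
    have ext: "\<alpha> \<in> extensional {1..Suc d}" and s: "(\<Sum>j=1..d. \<alpha> j) + \<alpha> (Suc d) \<le> r"
      using \<alpha> by (auto simp: multi_indices_def PiE_iff)
    have "\<alpha> j \<le> r - \<alpha> (Suc d)" if "j \<in> {1..d}" for j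
      using member_le_sum[of j "{1..d}" \<alpha>] that s by auto
    then have "?\<beta> \<in> multi_indices d (r - \<alpha> (Suc d))"
      using s by (auto simp: multi_indices_def)
    moreover have "\<alpha> = ?\<beta>(Suc d := \<alpha> (Suc d))"
      using ext by (auto simp: fun_eq_iff extensional_def le_Suc_eq)
    ultimately show "\<alpha> \<in> (\<Union>k\<le>r. (\<lambda>\<alpha>. \<alpha>(Suc d := k)) ` multi_indices d (r - k))"
      using s by (intro UN_I[of "\<alpha> (Suc d)"] image_eqI[where x = ?\<beta>]) auto
  qed
  have "card (multi_indices (Suc d) r) \<le> card (\<Union>k\<le>r. (\<lambda>\<alpha>. \<alpha>(Suc d := k)) ` multi_indices d (r - k))"
    by (rule card_mono[OF _ sub]) (simp add: finite_multi_indices)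
  also have "\<dots> \<le> (\<Sum>k\<le>r. card ((\<lambda>\<alpha>. \<alpha>(Suc d := k)) ` multi_indices d (r - k)))"
    by (rule card_UN_le) simp
  also have "\<dots> \<le> (\<Sum>k\<le>r. (r - k + d) choose d)"
    by (intro sum_mono order_trans[OF card_image_le Suc.IH] finite_multi_indices)
  also have "\<dots> = (\<Sum>k\<le>r. (d + k) choose d)"
    by (rule sum.reindex_bij_witness[of _ "\<lambda>k. r - k" "\<lambda>k. r - k"]) (auto simp: add.commute)
  also have "\<dots> = (r + Suc d) choose Suc d"
    using choose_rising_sum(1)[of d r] by (simp add: add.commute)
  finally show ?case .
qed

text \<open>Monomials cut off outside a piece, indexed by piece and exponent, form one finite family
  to which Gram-Schmidt applies.\<close>

definition piece_monomial :: "nat \<Rightarrow> nat \<Rightarrow> point set \<times> (nat \<Rightarrow> nat) \<Rightarrow> arr" where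
  "piece_monomial d n = (\<lambda>(R, \<alpha>) i. if i \<in> R then \<Prod>j=1..d. (real (i j) / real n) ^ \<alpha> j else 0)"

lemma sum_piece_monomial:
  assumes P: "partition_on (grid d n) P" "finite P" and R: "R \<in> P" "i \<in> R" and M: "finite M"
  shows "(\<Sum>x\<in>P \<times> M. c x * piece_monomial d n x i)
    = (\<Sum>\<alpha>\<in>M. c (R, \<alpha>) * (\<Prod>j=1..d. (real (i j) / real n) ^ \<alpha> j))"
proof -
  have uniq: "i \<in> R' \<longleftrightarrow> R' = R" if "R' \<in> P" for R'
    using partition_onD2[OF P(1)] R that by (auto simp: disjoint_def)
  have "(\<Sum>x\<in>P \<times> M. c x * piece_monomial d n x i)
      = (\<Sum>R'\<in>P. \<Sum>\<alpha>\<in>M. c (R', \<alpha>) * piece_monomial d n (R', \<alpha>) i)"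
    by (simp add: sum.cartesian_product case_prod_beta)
  also have "\<dots> = (\<Sum>R'\<in>P. if R' = R then \<Sum>\<alpha>\<in>M. c (R, \<alpha>) * (\<Prod>j=1..d. (real (i j) / real n) ^ \<alpha> j) else 0)"
    by (intro sum.cong refl) (auto simp: piece_monomial_def uniq)
  finally show ?thesis using P(2) R(1) by simp
qed

text \<open>Coefficients chosen separately on each piece glue to one coefficient function on pairs,
  because only the piece containing a given point contributes there.\<close>

lemma piecewise_poly_iff_spanned:
  assumes "partition_on (grid d n) P" "finite P"
  shows "\<theta> \<in> piecewise_poly r d n P \<longleftrightarrow> \<theta> \<in> arrays d n \<and>
    spanned (grid d n) (P \<times> multi_indices d r) (piece_monomial d n) \<theta>"
proof -
  let ?M = "multi_indices d r" and ?x = "\<lambda>i j. real (i j) / real n"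
  note sum = sum_piece_monomial[OF assms _ _ finite_multi_indices[of d r]]
  have "(\<forall>R\<in>P. \<exists>f\<in>poly_funs d r. \<forall>i\<in>R. \<theta> i = f (?x i))
    \<longleftrightarrow> (\<forall>R\<in>P. \<exists>c. \<forall>i\<in>R. \<theta> i = (\<Sum>\<alpha>\<in>?M. c \<alpha> * (\<Prod>j=1..d. ?x i j ^ \<alpha> j)))"
  proof (intro ball_cong refl iffI)
    fix R assume "\<exists>f\<in>poly_funs d r. \<forall>i\<in>R. \<theta> i = f (?x i)"
    then show "\<exists>c. \<forall>i\<in>R. \<theta> i = (\<Sum>\<alpha>\<in>?M. c \<alpha> * (\<Prod>j=1..d. ?x i j ^ \<alpha> j))"
      by (auto simp: poly_funs_def)
  next
    fix R assume "\<exists>c. \<forall>i\<in>R. \<theta> i = (\<Sum>\<alpha>\<in>?M. c \<alpha> * (\<Prod>j=1..d. ?x i j ^ \<alpha> j))"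
    then obtain c where "\<forall>i\<in>R. \<theta> i = (\<Sum>\<alpha>\<in>?M. c \<alpha> * (\<Prod>j=1..d. ?x i j ^ \<alpha> j))" by blast
    then show "\<exists>f\<in>poly_funs d r. \<forall>i\<in>R. \<theta> i = f (?x i)"
      by (intro bexI[of _ "\<lambda>x. \<Sum>\<alpha>\<in>?M. c \<alpha> * (\<Prod>j=1..d. x j ^ \<alpha> j)"]) (auto simp: poly_funs_def)
  qed
  also have "\<dots> \<longleftrightarrow> spanned (grid d n) (P \<times> ?M) (piece_monomial d n) \<theta>"
  proof
    assume "\<forall>R\<in>P. \<exists>c. \<forall>i\<in>R. \<theta> i = (\<Sum>\<alpha>\<in>?M. c \<alpha> * (\<Prod>j=1..d. ?x i j ^ \<alpha> j))"
    then obtain c where c: "\<forall>R\<in>P. \<forall>i\<in>R. \<theta> i = (\<Sum>\<alpha>\<in>?M. c R \<alpha> * (\<Prod>j=1..d. ?x i j ^ \<alpha> j))"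
      by metis
    have "\<theta> i = (\<Sum>x\<in>P \<times> ?M. (\<lambda>(R, \<alpha>). c R \<alpha>) x * piece_monomial d n x i)" if i: "i \<in> grid d n" for i
    proof -
      obtain R where R: "R \<in> P" "i \<in> R" using i partition_onD1[OF assms(1)] by blast
      show ?thesis using c R unfolding sum[OF R] by simp
    qed
    then show "spanned (grid d n) (P \<times> ?M) (piece_monomial d n) \<theta>"
      unfolding spanned_def by blast
  next
    assume "spanned (grid d n) (P \<times> ?M) (piece_monomial d n) \<theta>"
    then obtain c where c: "\<forall>i\<in>grid d n. \<theta> i = (\<Sum>x\<in>P \<times> ?M. c x * piece_monomial d n x i)"
      unfolding spanned_def by blast
    show "\<forall>R\<in>P. \<exists>c. \<forall>i\<in>R. \<theta> i = (\<Sum>\<alpha>\<in>?M. c \<alpha> * (\<Prod>j=1..d. ?x i j ^ \<alpha> j))"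
    proof
      fix R assume R: "R \<in> P"
      then have "R \<subseteq> grid d n" using partition_onD1[OF assms(1)] by blast
      then show "\<exists>c. \<forall>i\<in>R. \<theta> i = (\<Sum>\<alpha>\<in>?M. c \<alpha> * (\<Prod>j=1..d. ?x i j ^ \<alpha> j))"
        using c sum[OF R] by (intro exI[of _ "\<lambda>\<alpha>. c (R, \<alpha>)"]) auto
    qed
  qed
  finally show ?thesis by (simp add: piecewise_poly_def)
qed

lemma piecewise_poly_orthonormal_basis:
  assumes "P \<in> all_partitions d n"
  obtains m e where "m \<le> card P * ((r + d) choose d)" "orthonormal (grid d n) m e"
    "piecewise_poly r d n P = {\<theta> \<in> arrays d n. spanned (grid d n) {..<m} e \<theta>}"
proof -
  note P = all_partitionsD[OF assms]
  have "finite (P \<times> multi_indices d r)" using P(2) finite_multi_indices by blast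
  from orthonormal_basis[OF this, of "grid d n" "piece_monomial d n"] obtain m e where
    me: "m \<le> card (P \<times> multi_indices d r)" "orthonormal (grid d n) m e"
    "\<And>f. spanned (grid d n) {..<m} e f \<longleftrightarrow> spanned (grid d n) (P \<times> multi_indices d r) (piece_monomial d n) f"
    by auto
  have "m \<le> card P * ((r + d) choose d)"
    using order_trans[OF me(1)] card_multi_indices[of d r] by (simp add: card_cartesian_product)
  moreover have "piecewise_poly r d n P = {\<theta> \<in> arrays d n. spanned (grid d n) {..<m} e \<theta>}"
    using piecewise_poly_iff_spanned[OF P(1,2)] me(3) by blast
  ultimately show ?thesis using that me(2) by blast
qed

text \<open>The minimum is over a finite set, which is nonempty: on a dyadic partition into single
  points every array is piecewise constant.\<close>

lemma complexity_attained:
  assumes "n \<ge> 1" "\<theta> \<in> arrays d n"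
  shows "\<exists>P\<in>partitions c d n. \<theta> \<in> piecewise_poly r d n P \<and> card P = complexity c r d n \<theta>"
proof -
  let ?K = "{card P |P. P \<in> partitions c d n \<and> \<theta> \<in> piecewise_poly r d n P}"
  obtain P where P: "P \<in> rdp_partitions d n" "\<forall>R\<in>P. \<exists>x. R = {x}"
    using singletons_in_rdp_partitions[OF assms(1), of d] by blast
  have const: "(\<lambda>_. t) \<in> poly_funs d r" for t :: real
  proof -
    \<comment> \<open>The zero exponent, whose monomial is identically 1.\<close>
    let ?z = "restrict (\<lambda>_. 0::nat) {1..d}"
    have z: "?z \<in> multi_indices d r" by (auto simp: multi_indices_def)
    have "t = (\<Sum>\<alpha>\<in>multi_indices d r. (if \<alpha> = ?z then t else 0) * (\<Prod>j=1..d. x j ^ \<alpha> j))"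
      for x :: "nat \<Rightarrow> real"
    proof -
      have "(\<Sum>\<alpha>\<in>multi_indices d r. (if \<alpha> = ?z then t else 0) * (\<Prod>j=1..d. x j ^ \<alpha> j))
        = (\<Sum>\<alpha>\<in>multi_indices d r. if \<alpha> = ?z then t else 0)"
        by (intro sum.cong refl) auto
      then show ?thesis using z finite_multi_indices by simp
    qed
    then show ?thesis
      unfolding poly_funs_def
      by (intro CollectI exI[of _ "\<lambda>\<alpha>. if \<alpha> = ?z then t else 0"] allI)
  qed
  have "\<theta> \<in> piecewise_poly r d n P"
    unfolding piecewise_poly_def
  proof (intro CollectI conjI ballI assms(2))
    fix R assume "R \<in> P"
    with P(2) obtain x where "R = {x}" by (elim ballE exE) auto
    then show "\<exists>f\<in>poly_funs d r. \<forall>i\<in>R. \<theta> i = f (\<lambda>j. real (i j) / real n)"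
      using const[of "\<theta> x"] by (intro bexI[of _ "\<lambda>_. \<theta> x"]) auto
  qed
  then have "?K \<noteq> {}" using P(1) rdp_subset_partitions[OF assms(1)] by blast
  moreover have "finite ?K"
    using finite_subset[OF partitions_subset_all[OF assms(1)] finite_all_partitions]
    by (auto intro: finite_subset[of _ "card ` partitions c d n"])
  ultimately have "Min ?K \<in> ?K" by (rule Min_in[rotated])
  then show ?thesis unfolding complexity_def by auto
qed

section \<open>Projections and the penalized noise\<close>

text \<open>Resolves the definite description in \<open>orth_proj\<close> by showing existence and
  uniqueness. The explicit expansion is also what makes the projection measurable in
  \<open>y\<close>.\<close>

lemma orth_proj_eq:
  assumes e: "orthonormal (grid d n) m e" and S: "S = {\<theta> \<in> arrays d n. spanned (grid d n) {..<m} e \<theta>}"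
  shows "orth_proj d n S y = (\<lambda>i\<in>grid d n. \<Sum>j<m. dot (grid d n) y (e j) * e j i)"
    and "orth_proj d n S y \<in> S"
    and "s \<in> S \<Longrightarrow> dot (grid d n) (\<lambda>i. y i - orth_proj d n S y i) s = 0"
proof -
  let ?G = "grid d n"
  define p where "p = (\<lambda>i\<in>?G. \<Sum>j<m. dot ?G y (e j) * e j i)"
  have pS: "p \<in> S" unfolding p_def S spanned_def arrays_def by auto
  have orth: "dot ?G (\<lambda>i. y i - p i) s = 0" if "s \<in> S" for s
  proof -
    from that obtain c where c: "\<forall>i\<in>?G. s i = (\<Sum>j<m. c j * e j i)" by (auto simp: S spanned_def)
    have "dot ?G (\<lambda>i. y i - p i) s = dot ?G (\<lambda>i. y i - p i) (\<lambda>i. \<Sum>j<m. c j * e j i)"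
      using c by (intro dot_cong) auto
    also have "\<dots> = (\<Sum>j<m. c j * dot ?G (\<lambda>i. y i - p i) (e j))" by (rule dot_sum_right)
    also have "\<dots> = 0"
    proof (rule sum.neutral, rule ballI)
      fix j assume "j \<in> {..<m}"
      then have "dot ?G (e j) p = dot ?G y (e j)"
        using orthonormal_coeff[OF e, of j "\<lambda>j. dot ?G y (e j)"]
          dot_cong[of ?G "e j" "e j" p "\<lambda>i. \<Sum>j<m. dot ?G y (e j) * e j i"] by (simp add: p_def)
      then show "c j * dot ?G (\<lambda>i. y i - p i) (e j) = 0"
        unfolding dot_diff_left dot_commute[of ?G "e j"] by simp
    qed
    finally show ?thesis .
  qed
  have eq: "orth_proj d n S y = p"
    unfolding orth_proj_def
  proof (rule the_equality)
    show "p \<in> S \<and> (\<forall>s\<in>S. (\<Sum>i\<in>?G. (y i - p i) * s i) = 0)"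
      using pS orth unfolding dot_def by blast
    fix q assume q: "q \<in> S \<and> (\<forall>s\<in>S. (\<Sum>i\<in>?G. (y i - q i) * s i) = 0)"
    \<comment> \<open>The difference of two candidates lies in \<open>S\<close> and is orthogonal to
      \<open>S\<close>, hence to itself.\<close>
    define w where "w = (\<lambda>i\<in>?G. p i - q i)"
    have "spanned ?G {..<m} e w"
      by (rule spanned_combine[where f = p and g = q and a = 1 and b = "-1"])
        (use pS q in \<open>auto simp: S w_def\<close>)
    then have w: "w \<in> S" by (auto simp: S w_def arrays_def)
    have "dot ?G w w = dot ?G (\<lambda>i. (y i - q i) - (y i - p i)) w"
      by (rule dot_cong) (auto simp: w_def)
    also have "\<dots> = dot ?G (\<lambda>i. y i - q i) w - dot ?G (\<lambda>i. y i - p i) w"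
      by (rule dot_diff_left)
    also have "\<dots> = 0" using orth[OF w] q w unfolding dot_def by auto
    finally have "w i = 0" if "i \<in> ?G" for i
      using dot_self_eq_0[OF finite_grid] that by blast
    then have "q i = p i" if "i \<in> ?G" for i using that by (force simp: w_def)
    moreover have "q \<in> extensional ?G" "p \<in> extensional ?G"
      using q pS by (auto simp: S arrays_def PiE_iff)
    ultimately show "q = p" by (intro extensionalityI)
  qed
  show "orth_proj d n S y = (\<lambda>i\<in>?G. \<Sum>j<m. dot ?G y (e j) * e j i)"
    unfolding eq p_def ..
  show "orth_proj d n S y \<in> S" unfolding eq by (rule pS)
  show "dot ?G (\<lambda>i. y i - orth_proj d n S y i) s = 0" if "s \<in> S"
    unfolding eq by (rule orth[OF that])
qed

lemma orth_proj_piecewise_poly_in: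
  assumes "P \<in> all_partitions d n"
  shows "orth_proj d n (piecewise_poly r d n P) y \<in> piecewise_poly r d n P"
  by (rule piecewise_poly_orthonormal_basis[OF assms, of r]) (rule orth_proj_eq(2))

text \<open>Pythagoras: the residual y - p is orthogonal to both \<open>p\<close> and
  \<open>s\<close>, so the cross term vanishes.\<close>

lemma orth_proj_piecewise_poly_minimal:
  assumes "P \<in> all_partitions d n" and s: "s \<in> piecewise_poly r d n P"
  shows "dot (grid d n) (\<lambda>i. y i - orth_proj d n (piecewise_poly r d n P) y i)
      (\<lambda>i. y i - orth_proj d n (piecewise_poly r d n P) y i)
    \<le> dot (grid d n) (\<lambda>i. y i - s i) (\<lambda>i. y i - s i)"
proof -
  let ?G = "grid d n"
  define S where "S = piecewise_poly r d n P"
  define p where "p = orth_proj d n S y"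
  obtain m e where e: "orthonormal ?G m e" and S: "S = {\<theta> \<in> arrays d n. spanned ?G {..<m} e \<theta>}"
    using piecewise_poly_orthonormal_basis[OF assms(1), of r] unfolding S_def by metis
  have p: "p \<in> S" and orth: "\<And>s. s \<in> S \<Longrightarrow> dot ?G (\<lambda>i. y i - p i) s = 0"
    unfolding p_def using orth_proj_eq(2,3)[OF e S] by auto
  have cross: "dot ?G (\<lambda>i. y i - p i) p - dot ?G (\<lambda>i. y i - p i) s = 0"
    using orth p s by (simp add: S_def)
  have "dot ?G (\<lambda>i. y i - s i) (\<lambda>i. y i - s i)
      = dot ?G (\<lambda>i. y i - p i) (\<lambda>i. y i - p i) + dot ?G (\<lambda>i. p i - s i) (\<lambda>i. p i - s i)
        + 2 * (dot ?G (\<lambda>i. y i - p i) p - dot ?G (\<lambda>i. y i - p i) s)"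
    unfolding dot_def sum_distrib_left sum_subtractf[symmetric] sum.distrib[symmetric]
    by (intro sum.cong refl) (simp add: algebra_simps)
  then show ?thesis
    using cross dot_self_nonneg[of ?G "\<lambda>i. p i - s i"] by (simp add: p_def S_def)
qed

text \<open>Adjoining \<theta> as one more generator, at the cost of one dimension, puts every
  difference q - \<theta> into a linear space that does not depend on the data, even if \<theta> is
  not in the space of \<open>P\<close>.\<close>

lemma piecewise_poly_translate_basis:
  assumes "P \<in> all_partitions d n"
  shows "\<exists>m e. m \<le> Suc (card P * ((r + d) choose d)) \<and> m \<le> n ^ d \<and> orthonormal (grid d n) m e \<and>
    (\<forall>q\<in>piecewise_poly r d n P. spanned (grid d n) {..<m} e (\<lambda>i. q i - \<theta> i))"
proof -
  let ?G = "grid d n"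
  obtain m e where m: "m \<le> card P * ((r + d) choose d)"
    and S: "piecewise_poly r d n P = {\<theta> \<in> arrays d n. spanned ?G {..<m} e \<theta>}"
    by (rule piecewise_poly_orthonormal_basis[OF assms, of r])
  from orthonormal_basis[of "insert m {..<m}" ?G "e(m := \<theta>)"] obtain m' e' where
    e': "m' \<le> Suc m" "orthonormal ?G m' e'"
    "\<And>f. spanned ?G {..<m'} e' f \<longleftrightarrow> spanned ?G (insert m {..<m}) (e(m := \<theta>)) f"
    by auto
  have "spanned ?G {..<m'} e' (\<lambda>i. q i - \<theta> i)" if "q \<in> piecewise_poly r d n P" for q
  proof -
    from that have "spanned ?G {..<m} (e(m := \<theta>)) q" by (auto simp: S spanned_def)
    then have "spanned ?G {..<m} (e(m := \<theta>)) (\<lambda>i. (q i - \<theta> i) - (-1) * (e(m := \<theta>)) m i)"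
      by simp
    then show ?thesis
      unfolding e'(3) by (subst spanned_insert) (auto simp only: finite_lessThan lessThan_iff)
  qed
  moreover have "m' \<le> n ^ d"
    using orthonormal_card_le[OF e'(2)] by (simp add: card_grid)
  ultimately show ?thesis using e'(1,2) m by (intro exI[of _ m'] exI[of _ e']) auto
qed

section \<open>Union bound over all partitions\<close>

lemma sum_power_card_partitions:
  assumes "n \<ge> 1"
  shows "(\<Sum>P\<in>all_partitions d n. (1 / (real (n ^ d))\<^sup>2) ^ card P) \<le> exp 1"
proof -
  let ?R = "{R. rectangle d n R}" and ?x = "1 / (real (n ^ d))\<^sup>2"
  \<comment> \<open>A partition is a set of rectangles; summing over all sets of rectangles instead
    yields a product with one factor per rectangle.\<close>
  have "(\<Sum>P\<in>all_partitions d n. ?x ^ card P) \<le> (\<Sum>P\<in>Pow ?R. ?x ^ card P)"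
    by (rule sum_mono2) (use all_partitions_subset finite_rectangles in auto)
  also have "\<dots> = (\<Prod>R\<in>?R. ?x + 1)"
    by (subst prod_add) (simp_all add: finite_rectangles)
  also have "\<dots> = (1 + ?x) ^ card ?R" by (simp add: add.commute)
  also have "\<dots> \<le> exp ?x ^ card ?R"
    by (intro power_mono exp_ge_add_one_self) simp
  also have "\<dots> = exp (real (card ?R) * ?x)" by (rule exp_of_nat_mult[symmetric])
  also have "\<dots> \<le> exp 1"
  proof -
    have "real (card ?R) \<le> real ((n ^ d)\<^sup>2)" using card_rectangles of_nat_le_iff by blast
    then have "real (card ?R) \<le> (real (n ^ d))\<^sup>2" by simp
    then show ?thesis using assms by (simp add: divide_le_eq)
  qed
  finally show ?thesis .
qed

lemma chi_square_penalty_bound: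
  fixes N K k m :: nat and L :: real
  assumes "N \<ge> 1" "K \<ge> 1" "m \<le> Suc (k * K)" "m \<le> N" and L: "L \<ge> 20 * real K * ln (real N)"
  shows "sqrt 2 ^ m * exp (- (L * real k / 4)) \<le> sqrt 2 * (1 / (real N)\<^sup>2) ^ k"
proof (cases "N = 1")
  \<comment> \<open>Here the logarithm vanishes and \<open>L\<close> may be 0, so the penalty gives
    no decay; the bound \<open>m\<close> \<le> \<open>N\<close> = 1 takes its place.\<close>
  case True
  then have "sqrt 2 ^ m \<le> sqrt 2 ^ 1" using assms by (intro power_increasing) auto
  moreover have "exp (- (L * real k / 4)) \<le> 1" using L True by simp
  ultimately have "sqrt 2 ^ m * exp (- (L * real k / 4)) \<le> sqrt 2 ^ 1 * 1"
    by (intro mult_mono) auto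
  then show ?thesis using True by simp
next
  case False
  then have N: "real N \<ge> 2" using assms(1) by simp
  have "sqrt 2 ^ m \<le> sqrt 2 ^ Suc (k * K)" using assms(3) by (intro power_increasing) auto
  also have "\<dots> \<le> sqrt 2 * real N ^ (k * K)"
    using N sqrt2_less_2 by (auto intro!: power_mono)
  finally have 1: "sqrt 2 ^ m \<le> sqrt 2 * real N ^ (k * K)" .
  \<comment> \<open>The constant 20 leaves exponent 5 after division by 4: one power of
    \<open>N\<close> per unit of \<open>k * K\<close> absorbs the moment bound, and the other four
    cover the required \<open>2 * k\<close>.\<close>
  have "5 * real K * ln (real N) * real k \<le> L * real k / 4"
    using mult_right_mono[OF L, of "real k"] by simp
  then have "exp (- (L * real k / 4)) \<le> exp (- (real (5 * (k * K)) * ln (real N)))"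
    by (simp add: algebra_simps)
  also have "\<dots> = 1 / real N ^ (5 * (k * K))"
    using N by (simp only: exp_minus exp_of_nat_mult) (simp add: divide_inverse)
  finally have 2: "exp (- (L * real k / 4)) \<le> 1 / real N ^ (5 * (k * K))" .
  have "sqrt 2 ^ m * exp (- (L * real k / 4)) \<le> sqrt 2 * real N ^ (k * K) * (1 / real N ^ (5 * (k * K)))"
    using 1 2 N by (intro mult_mono) auto
  also have "\<dots> = sqrt 2 * (1 / real N ^ (4 * (k * K)))"
  proof -
    have "real N ^ (5 * (k * K)) = real N ^ (k * K) * real N ^ (4 * (k * K))"
      unfolding power_add[symmetric] by (simp add: mult.commute)
    then show ?thesis using N by simp
  qed
  also have "\<dots> \<le> sqrt 2 * (1 / real N ^ (2 * k))"
  proof -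
    have "2 * k \<le> 4 * (k * K)" using assms(2) by (cases K) auto
    then have "real N ^ (2 * k) \<le> real N ^ (4 * (k * K))" using N by (intro power_increasing) auto
    then show ?thesis using N by (intro mult_left_mono divide_left_mono) auto
  qed
  also have "\<dots> = sqrt 2 * (1 / (real N)\<^sup>2) ^ k" by (simp add: power_mult power_one_over)
  finally show ?thesis .
qed

lemma gaussian_noise_eq: "gaussian_noise d n = PiM (grid d n) (\<lambda>_. std_normal)"
  by (simp add: gaussian_noise_def std_normal_def)

lemma measurable_dot_noise:
  "(\<lambda>z. dot (grid d n) z v) \<in> borel_measurable (PiM (grid d n) (\<lambda>_. std_normal))"
  unfolding dot_def by measurable

text \<open>The finite sum is integrated term by term: each chi-square moment is beaten by its own
  penalty, and what remains is summable over partitions.\<close>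

lemma nn_integral_penalized_projection:
  assumes n: "n \<ge> 1" and L: "L \<ge> 20 * real ((r + d) choose d) * ln (real (n ^ d))"
    and m: "\<And>P. P \<in> all_partitions d n \<Longrightarrow> m P \<le> Suc (card P * ((r + d) choose d)) \<and> m P \<le> n ^ d"
    and e: "\<And>P. P \<in> all_partitions d n \<Longrightarrow> orthonormal (grid d n) (m P) (e P)"
  defines "X \<equiv> (\<lambda>z. \<Sum>P\<in>all_partitions d n.
      exp (((\<Sum>j<m P. (dot (grid d n) z (e P j))\<^sup>2) - L * real (card P)) / 4))"
  shows "(\<integral>\<^sup>+z. ennreal (X z) \<partial>gaussian_noise d n) \<le> ennreal (sqrt 2 * exp 1)"
proof -
  let ?G = "grid d n" and ?M = "gaussian_noise d n"
  note [measurable] = measurable_dot_noise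
  have split: "exp ((w - L * real k) / 4) = exp (- (L * real k / 4)) * exp (w / 4)" for w k
    by (simp add: exp_add[symmetric] field_simps)
  have "(\<integral>\<^sup>+z. ennreal (X z) \<partial>?M) = (\<integral>\<^sup>+z. (\<Sum>P\<in>all_partitions d n.
      ennreal (exp (- (L * real (card P) / 4))) * ennreal (exp ((\<Sum>j<m P. (dot ?G z (e P j))\<^sup>2) / 4))) \<partial>?M)"
    unfolding X_def split by (simp add: sum_ennreal[symmetric] ennreal_mult)
  also have "\<dots> = (\<Sum>P\<in>all_partitions d n. ennreal (exp (- (L * real (card P) / 4)))
      * (\<integral>\<^sup>+z. ennreal (exp ((\<Sum>j<m P. (dot ?G z (e P j))\<^sup>2) / 4)) \<partial>?M))"
    unfolding gaussian_noise_eq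
    by (subst nn_integral_sum) (simp_all add: nn_integral_cmult)
  also have "\<dots> = (\<Sum>P\<in>all_partitions d n. ennreal (sqrt 2 ^ m P * exp (- (L * real (card P) / 4))))"
    unfolding gaussian_noise_eq
    by (intro sum.cong refl) (simp add: nn_integral_exp_projected_noise e ennreal_mult[symmetric] mult.commute)
  also have "\<dots> = ennreal (\<Sum>P\<in>all_partitions d n. sqrt 2 ^ m P * exp (- (L * real (card P) / 4)))"
    by (rule sum_ennreal) simp
  also have "\<dots> \<le> ennreal (\<Sum>P\<in>all_partitions d n. sqrt 2 * (1 / (real (n ^ d))\<^sup>2) ^ card P)"
  proof (intro ennreal_leI sum_mono)
    fix P assume P: "P \<in> all_partitions d n"
    show "sqrt 2 ^ m P * exp (- (L * real (card P) / 4)) \<le> sqrt 2 * (1 / (real (n ^ d))\<^sup>2) ^ card P"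
      using m[OF P] n L
      by (intro chi_square_penalty_bound[where K = "(r + d) choose d"]) (auto simp: Suc_le_eq zero_less_binomial)
  qed
  also have "\<dots> \<le> ennreal (sqrt 2 * exp 1)"
    unfolding sum_distrib_left[symmetric]
    by (intro ennreal_leI mult_left_mono sum_power_card_partitions n) simp
  finally show ?thesis .
qed

section \<open>Measurability of the loss and the risk bound\<close>

lemma measurable_estimator_loss:
  assumes n: "n \<ge> 1"
    and sel: "sel \<in> (\<Pi>\<^sub>M i\<in>grid d n. borel) \<rightarrow>\<^sub>M count_space (partitions c d n)"
  shows "(\<lambda>z. dot (grid d n) (\<lambda>i. estimator r d n sel (observation d n \<sigma> \<theta>s z) i - \<theta>s i)
      (\<lambda>i. estimator r d n sel (observation d n \<sigma> \<theta>s z) i - \<theta>s i)) \<in> borel_measurable (gaussian_noise d n)"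
proof -
  let ?G = "grid d n" and ?B = "\<Pi>\<^sub>M i\<in>grid d n. (borel :: real measure)"
  define h where "h P y = dot ?G (\<lambda>i. orth_proj d n (piecewise_poly r d n P) y i - \<theta>s i)
      (\<lambda>i. orth_proj d n (piecewise_poly r d n P) y i - \<theta>s i)" for P y
  have fin: "finite (partitions c d n)"
    using partitions_subset_all[OF n] finite_all_partitions by (rule finite_subset)
  have h: "h P \<in> borel_measurable ?B" if "P \<in> partitions c d n" for P
  proof -
    from that have "P \<in> all_partitions d n" using partitions_subset_all[OF n] by blast
    then obtain m e where e: "orthonormal ?G m e"
      and S: "piecewise_poly r d n P = {\<theta> \<in> arrays d n. spanned ?G {..<m} e \<theta>}"
      using piecewise_poly_orthonormal_basis by metis
    \<comment> \<open>For a fixed partition the loss is a polynomial in the entries of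
      \<open>y\<close>.\<close>
    have h_eq: "h P = (\<lambda>y. \<Sum>i\<in>?G. ((\<Sum>j<m. (\<Sum>i\<in>?G. y i * e j i) * e j i) - \<theta>s i)
        * ((\<Sum>j<m. (\<Sum>i\<in>?G. y i * e j i) * e j i) - \<theta>s i))"
      unfolding h_def orth_proj_eq(1)[OF e S] by (simp add: dot_def)
    show ?thesis unfolding h_eq by measurable
  qed
  have obs: "observation d n \<sigma> \<theta>s \<in> gaussian_noise d n \<rightarrow>\<^sub>M ?B"
    unfolding observation_def gaussian_noise_eq by measurable
  \<comment> \<open>The selector takes finitely many values, so the fixed-partition losses are
    patched together along its measurable level sets.\<close>
  have "(\<lambda>y. h (sel y) y) \<in> borel_measurable ?B"
    using h sel countable_finite[OF fin] by (rule measurable_compose_countable')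
  from measurable_compose[OF obs this] show ?thesis
    by (simp add: h_def estimator_def)
qed

lemma estimator_risk_bound:
  fixes \<theta>s :: arr
  assumes n: "n \<ge> 1" and \<sigma>: "\<sigma> > 0" and \<delta>: "0 < \<delta>" "\<delta> < 1" and \<theta>: "\<theta> \<in> arrays d n"
    and lam: "lam \<ge> 40 * real ((r + d) choose d) * (\<sigma>\<^sup>2 * ln (real (n ^ d)) / \<delta>)"
    and sel: "optimal_selector c r d n lam sel"
  defines "loss \<equiv> (\<lambda>z. (L2_set (\<lambda>i. estimator r d n sel (observation d n \<sigma> \<theta>s z) i - \<theta>s i)
                          (grid d n))\<^sup>2)"
  shows "integrable (gaussian_noise d n) loss"
    and "integral\<^sup>L (gaussian_noise d n) loss
      \<le> (1 + \<delta>) / (1 - \<delta>) * (L2_set (\<lambda>i. \<theta> i - \<theta>s i) (grid d n))\<^sup>2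
        + lam / (1 - \<delta>) * real (complexity c r d n \<theta>) + 40 * (\<sigma>\<^sup>2 / (\<delta> * (1 - \<delta>)))"
proof -
  let ?G = "grid d n" and ?M = "gaussian_noise d n"
  interpret prob_space ?M
    unfolding gaussian_noise_eq by (intro prob_space_PiM prob_space_std_normal)
  have sel_meas: "sel \<in> (\<Pi>\<^sub>M i\<in>?G. borel) \<rightarrow>\<^sub>M count_space (partitions c d n)"
    and sel_opt: "\<And>y P. y \<in> arrays d n \<Longrightarrow> P \<in> partitions c d n \<Longrightarrow>
      penalized_loss r d n lam y (sel y) \<le> penalized_loss r d n lam y P"
    using sel by (auto simp: optimal_selector_def)
  have part: "P \<in> partitions c d n \<Longrightarrow> P \<in> all_partitions d n" for P
    using partitions_subset_all[OF n] by blast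
  obtain Q where Q: "Q \<in> partitions c d n" "\<theta> \<in> piecewise_poly r d n Q" "card Q = complexity c r d n \<theta>"
    using complexity_attained[OF n \<theta>] by blast
  \<comment> \<open>Bases are chosen once for all partitions, before the noise is drawn, so that the
    Gaussian moment formula applies to each of them.\<close>
  have "\<forall>P\<in>all_partitions d n. \<exists>m. \<exists>e. m \<le> Suc (card P * ((r + d) choose d)) \<and> m \<le> n ^ d \<and>
      orthonormal ?G m e \<and> (\<forall>q\<in>piecewise_poly r d n P. spanned ?G {..<m} e (\<lambda>i. q i - \<theta> i))"
    using piecewise_poly_translate_basis by blast
  from bchoice[OF this] obtain m where "\<forall>P\<in>all_partitions d n. \<exists>e.
      m P \<le> Suc (card P * ((r + d) choose d)) \<and> m P \<le> n ^ d \<and> orthonormal ?G (m P) e \<and>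
      (\<forall>q\<in>piecewise_poly r d n P. spanned ?G {..<m P} e (\<lambda>i. q i - \<theta> i))" by (elim exE)
  from bchoice[OF this] obtain e where me: "\<forall>P\<in>all_partitions d n.
      m P \<le> Suc (card P * ((r + d) choose d)) \<and> m P \<le> n ^ d \<and> orthonormal ?G (m P) (e P) \<and>
      (\<forall>q\<in>piecewise_poly r d n P. spanned ?G {..<m P} (e P) (\<lambda>i. q i - \<theta> i))" by (elim exE)
  have m: "m P \<le> Suc (card P * ((r + d) choose d)) \<and> m P \<le> n ^ d"
    and e: "orthonormal ?G (m P) (e P)"
    and span: "q \<in> piecewise_poly r d n P \<Longrightarrow> spanned ?G {..<m P} (e P) (\<lambda>i. q i - \<theta> i)"
    if "P \<in> all_partitions d n" for P q
    using bspec[OF me that] by auto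
  \<comment> \<open>The penalty in units of the factor 2 * \<sigma> * \<sigma> / \<delta> of the
    noise term; this rescaling turns the threshold constant 40 into 20.\<close>
  define L where "L = lam * \<delta> / (2 * \<sigma>\<^sup>2)"
  have L: "L \<ge> 20 * real ((r + d) choose d) * ln (real (n ^ d))"
    using lam \<sigma> \<delta> by (simp add: L_def field_simps)
  define W where "W P z = (\<Sum>j<m P. (dot ?G z (e P j))\<^sup>2)" for P z
  define X where "X z = (\<Sum>P\<in>all_partitions d n. exp ((W P z - L * real (card P)) / 4))" for z
  define T where "T = (1 + \<delta>) / (1 - \<delta>) * (L2_set (\<lambda>i. \<theta> i - \<theta>s i) ?G)\<^sup>2
        + lam / (1 - \<delta>) * real (complexity c r d n \<theta>)"
  define B where "B = 8 * \<sigma>\<^sup>2 / (\<delta> * (1 - \<delta>))"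
  have B: "B \<ge> 0" using \<delta> by (simp add: B_def)
  have bound: "loss z \<le> T + B * X z" for z
  proof -
    define y where "y = observation d n \<sigma> \<theta>s z"
    have y: "y \<in> arrays d n" by (auto simp: y_def observation_def arrays_def)
    define P where "P = sel y"
    \<comment> \<open>Measurability into \<open>count_space\<close> is what forces the selected
      value to be an admissible partition.\<close>
    have "P \<in> partitions c d n"
      using measurable_space[OF sel_meas, of y] y by (simp add: P_def space_PiM arrays_def)
    note P = part[OF this]
    define p where "p = orth_proj d n (piecewise_poly r d n P) y"
    have loss: "loss z = dot ?G (\<lambda>i. p i - \<theta>s i) (\<lambda>i. p i - \<theta>s i)"
      unfolding loss_def L2_set_power2 estimator_def p_def P_def y_def ..
    have "dot ?G (\<lambda>i. y i - p i) (\<lambda>i. y i - p i) + lam * real (card P)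
        \<le> dot ?G (\<lambda>i. y i - \<theta> i) (\<lambda>i. y i - \<theta> i) + lam * real (card Q)"
      using sel_opt[OF y Q(1)] orth_proj_piecewise_poly_minimal[OF part[OF Q(1)] Q(2), of y]
      by (simp add: penalized_loss_def L2_set_power2 p_def P_def)
    from penalized_oracle_inequality[OF e[OF P] span[OF P] _ \<delta>(1) this, where s = \<theta>s and \<sigma> = \<sigma> and z = z]
    have "(1 - \<delta>) * loss z \<le> (1 + \<delta>) * (L2_set (\<lambda>i. \<theta> i - \<theta>s i) ?G)\<^sup>2 + lam * real (card Q)
      + (2 * \<sigma>\<^sup>2 / \<delta> * W P z - lam * real (card P))"
      unfolding loss W_def L2_set_power2
      using orth_proj_piecewise_poly_in[OF P] by (simp add: p_def y_def observation_def)
    also have "2 * \<sigma>\<^sup>2 / \<delta> * W P z - lam * real (card P) = 2 * \<sigma>\<^sup>2 / \<delta> * (W P z - L * real (card P))"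
      using \<sigma> \<delta> by (simp add: L_def field_simps)
    also have "\<dots> \<le> 2 * \<sigma>\<^sup>2 / \<delta> * (4 * X z)"
    proof (rule mult_left_mono)
      have "(W P z - L * real (card P)) / 4 \<le> exp ((W P z - L * real (card P)) / 4)"
        using exp_ge_add_one_self[of "(W P z - L * real (card P)) / 4"] by linarith
      \<comment> \<open>The selected \<open>P\<close> depends on \<open>z\<close>; adding the
        positive terms of all other partitions removes this dependence.\<close>
      also have "\<dots> \<le> X z"
        unfolding X_def by (rule member_le_sum[OF P _ finite_all_partitions]) simp
      finally show "W P z - L * real (card P) \<le> 4 * X z" by simp
    qed (use \<delta> in simp)
    finally have "loss z \<le> ((1 + \<delta>) * (L2_set (\<lambda>i. \<theta> i - \<theta>s i) ?G)\<^sup>2 + lam * real (card Q)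
      + 2 * \<sigma>\<^sup>2 / \<delta> * (4 * X z)) / (1 - \<delta>)"
      using \<delta>(2) by (simp add: pos_le_divide_eq mult.commute)
    also have "\<dots> = T + B * X z"
    proof -
      have "((1 + \<delta>) * u + lam * k + 2 * s / \<delta> * (4 * x)) / t
          = (1 + \<delta>) / t * u + lam / t * k + 8 * s / (\<delta> * t) * x" if "t > 0" for u k s x t
        using \<delta>(1) that by (simp add: field_simps)
      from this[of "1 - \<delta>"] show ?thesis using \<delta>(2) by (simp add: T_def B_def Q(3))
    qed
    finally show ?thesis .
  qed
  have X_nonneg: "X z \<ge> 0" for z by (simp add: X_def sum_nonneg)
  have X_int: "(\<integral>\<^sup>+z. ennreal (X z) \<partial>?M) \<le> ennreal (sqrt 2 * exp 1)"
    unfolding X_def W_def by (rule nn_integral_penalized_projection[OF n L m e])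
  note [measurable] = measurable_dot_noise
  have X_meas: "X \<in> borel_measurable ?M"
    unfolding X_def[abs_def] W_def gaussian_noise_eq by measurable
  have X: "integrable ?M X"
    using X_meas X_nonneg X_int by (intro integrableI_nonneg) (auto simp: le_less_trans)
  have EX: "integral\<^sup>L ?M X \<le> sqrt 2 * exp 1"
    using X_int nn_integral_eq_integral[OF X] X_nonneg by (simp add: ennreal_le_iff)
  have TX: "integrable ?M (\<lambda>z. T + B * X z)" using X by simp
  have "loss \<in> borel_measurable ?M"
    unfolding loss_def L2_set_power2 by (rule measurable_estimator_loss[OF n sel_meas])
  \<comment> \<open>The nonnegative loss is dominated by the integrable function T + B * X.\<close>
  then show int: "integrable ?M loss"
    using bound by (intro Bochner_Integration.integrable_bound[OF TX])
      (auto simp: loss_def intro!: AE_I2 order_trans[OF _ abs_ge_self])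
  have "integral\<^sup>L ?M loss \<le> (\<integral>z. T + B * X z \<partial>?M)"
    by (rule integral_mono[OF int TX bound])
  also have "\<dots> = T + B * integral\<^sup>L ?M X" using X by (simp add: prob_space)
  \<comment> \<open>Since \<open>sqrt 2 * exp 1\<close> is at most 5 and \<open>B\<close> carries a
    factor 8, the remainder has constant 40.\<close>
  also have "\<dots> \<le> T + B * 5"
  proof -
    have "sqrt 2 \<le> (5 / 3 :: real)" by (rule real_le_lsqrt) (simp_all add: power2_eq_square)
    then have "sqrt 2 * exp 1 \<le> (5 / 3) * (3 :: real)" using exp_le by (intro mult_mono) auto
    then show ?thesis using EX B by (intro add_left_mono mult_left_mono) auto
  qed
  finally show "integral\<^sup>L ?M loss \<le> (1 + \<delta>) / (1 - \<delta>) * (L2_set (\<lambda>i. \<theta> i - \<theta>s i) ?G)\<^sup>2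
        + lam / (1 - \<delta>) * real (complexity c r d n \<theta>) + 40 * (\<sigma>\<^sup>2 / (\<delta> * (1 - \<delta>)))"
    by (simp add: T_def B_def)
qed

theorem theorem2p1:
  shows "\<exists>C::real. C > 0 \<and>
    (\<forall>(r::nat) (n::nat) (d::nat) (\<sigma>::real) (\<theta>s::arr) (\<delta>::real) (lam::real)
      (a::partition_class) (sel :: arr \<Rightarrow> point set set).
      n \<ge> 1 \<longrightarrow> d \<ge> 1 \<longrightarrow> \<sigma> > 0 \<longrightarrow> \<theta>s \<in> arrays d n \<longrightarrow> 0 < \<delta> \<longrightarrow> \<delta> < 1 \<longrightarrow>
      lam \<ge> C * real ((r + d) choose d) * (\<sigma>\<^sup>2 * ln (real (n ^ d)) / \<delta>) \<longrightarrow>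
      optimal_selector a r d n lam sel \<longrightarrow>
      (let loss = (\<lambda>z. (L2_set (\<lambda>i. estimator r d n sel (observation d n \<sigma> \<theta>s z) i - \<theta>s i)
                          (grid d n))\<^sup>2)
       in integrable (gaussian_noise d n) loss \<and>
          integral\<^sup>L (gaussian_noise d n) loss
            \<le> (INF \<theta>\<in>arrays d n.
                 (1 + \<delta>) / (1 - \<delta>) * (L2_set (\<lambda>i. \<theta> i - \<theta>s i) (grid d n))\<^sup>2
                 + lam / (1 - \<delta>) * real (complexity a r d n \<theta>))
              + C * (\<sigma>\<^sup>2 / (\<delta> * (1 - \<delta>)))))"
proof (intro exI[of _ "40::real"] conjI allI impI)
  fix r n d :: nat and \<sigma> :: real and \<theta>s :: arr and \<delta> lam :: real and a :: partition_class
    and sel :: "arr \<Rightarrow> point set set"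
  assume h: "n \<ge> 1" "d \<ge> 1" "\<sigma> > 0" "\<theta>s \<in> arrays d n" "0 < \<delta>" "\<delta> < 1"
    "lam \<ge> 40 * real ((r + d) choose d) * (\<sigma>\<^sup>2 * ln (real (n ^ d)) / \<delta>)"
    "optimal_selector a r d n lam sel"
  define loss where "loss = (\<lambda>z. (L2_set (\<lambda>i. estimator r d n sel (observation d n \<sigma> \<theta>s z) i - \<theta>s i)
                          (grid d n))\<^sup>2)"
  \<comment> \<open>The constant 40 serves twice: as threshold for \<open>lam\<close>, where it is 2
    * 20, and in the remainder, where it is 8 * 5.\<close>
  note risk = estimator_risk_bound[OF h(1,3,5,6) _ h(7,8), where \<theta>s = \<theta>s, folded loss_def]
  \<comment> \<open>With the remainder moved to the left, the risk is a lower bound for every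
    competitor, hence for the infimum.\<close>
  have "integral\<^sup>L (gaussian_noise d n) loss - 40 * (\<sigma>\<^sup>2 / (\<delta> * (1 - \<delta>)))
      \<le> (INF \<theta>\<in>arrays d n. (1 + \<delta>) / (1 - \<delta>) * (L2_set (\<lambda>i. \<theta> i - \<theta>s i) (grid d n))\<^sup>2
                 + lam / (1 - \<delta>) * real (complexity a r d n \<theta>))"
  proof (rule cINF_greatest)
    show "arrays d n \<noteq> {}" using h(4) by blast
  qed (use risk(2) in \<open>simp add: diff_le_eq\<close>)
  then show "let loss = (\<lambda>z. (L2_set (\<lambda>i. estimator r d n sel (observation d n \<sigma> \<theta>s z) i - \<theta>s i)
                          (grid d n))\<^sup>2)
       in integrable (gaussian_noise d n) loss \<and>
          integral\<^sup>L (gaussian_noise d n) loss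
            \<le> (INF \<theta>\<in>arrays d n.
                 (1 + \<delta>) / (1 - \<delta>) * (L2_set (\<lambda>i. \<theta> i - \<theta>s i) (grid d n))\<^sup>2
                 + lam / (1 - \<delta>) * real (complexity a r d n \<theta>))
              + 40 * (\<sigma>\<^sup>2 / (\<delta> * (1 - \<delta>)))"
    using risk(1)[OF h(4)] unfolding Let_def loss_def[symmetric] by (simp add: diff_le_eq)
qed simp

end
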